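(* Let $\sigma_*>0$ be the unique positive root of $\sigma=\coth\sigma$. Then the function $H(a):=\sinh r(a)/K(a)$ admits the asymptotic expansion $$H(a)=\sigma_*\cosh\sigma_*+C_0\,(a-\tfrac12)+O\bigl((a-\tfrac12)^2\bigr)\qquad(a\to(1/2)^+),$$ where $$C_0=H'((1/2)^+)=\frac{\sigma_*\cosh\sigma_*\,(\sinh^2\sigma_*-1)\,(3\sinh^2\sigma_*-2)}{12\sinh^2\sigma_*}>0.$$ Equivalently, $g(a):=K(a)^2r'(a)-a\tanh r(a)$ has the asymptotic $$g(a)=C_0\,(a-\tfrac12)^{3/2}+O\bigl((a-\tfrac12)^{5/2}\bigr)\qquad(a\to(1/2)^+).$$
   Context: For $a>1/2$ put $A(s)=\sqrt{a\cosh(2s)+\tfrac12}$, $B(s)=\sqrt{a\cosh(2s)-\tfrac12}$, $K(a)=\sqrt{a^2-\tfrac14}$, and $\varphi(s)=\int_0^s\frac{K(a)}{A(t)^2B(t)}\,dt$. Let $s_0(a)>0$ be the unique positive solution of $\tanh\varphi(s_0)=\frac{B(s_0)K(a)}{a\sinh(2s_0)}$, and let $r(a)>0$ be defined by $\cosh r(a)=A(s_0(a))\cosh\varphi(s_0(a))$. (Here $r(a)$ is the radius of the geodesic ball of $\mathbb{H}^3$ in which the critical spherical catenoid with parameter $a$ is a free boundary minimal surface; it is a real-analytic function of $a\in(1/2,\infty)$.) $H'((1/2)^+)$ denotes $\lim_{a\to(1/2)^+}H'(a)$, equivalently the right derivative at $1/2$ of the continuous extension of $H$. *)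

theory Defs
  imports "HOL-Analysis.Analysis" "HOL-Library.Landau_Symbols"
begin

text \<open>Throughout, the parameter \<open>a\<close> is meant to satisfy \<open>a > 1/2\<close>; values elsewhere are irrelevant.\<close>

definition catA :: "real \<Rightarrow> real \<Rightarrow> real" where
  "catA a s = sqrt (a * cosh (2 * s) + 1 / 2)"

definition catB :: "real \<Rightarrow> real \<Rightarrow> real" where
  "catB a s = sqrt (a * cosh (2 * s) - 1 / 2)"

definition catK :: "real \<Rightarrow> real" where
  "catK a = sqrt (a\<^sup>2 - 1 / 4)"

definition catphi :: "real \<Rightarrow> real \<Rightarrow> real" where
  "catphi a s = (LBINT t=0..s. catK a / ((catA a t)\<^sup>2 * catB a t))"

definition s0 :: "real \<Rightarrow> real" where
  "s0 a = (THE s. s > 0 \<and> tanh (catphi a s) = catB a s * catK a / (a * sinh (2 * s)))"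

text \<open>The radius of the geodesic ball of hyperbolic 3-space in which the critical spherical
  catenoid with parameter \<open>a\<close> is a free boundary minimal surface.\<close>

definition ball_radius :: "real \<Rightarrow> real" where
  "ball_radius a = (THE r. r > 0 \<and> cosh r = catA a (s0 a) * cosh (catphi a (s0 a)))"

definition coth :: "real \<Rightarrow> real" where
  "coth x = cosh x / sinh x"

definition sigma_star :: real where
  "sigma_star = (THE \<sigma>. \<sigma> > 0 \<and> \<sigma> = coth \<sigma>)"

definition H :: "real \<Rightarrow> real" where
  "H a = sinh (ball_radius a) / catK a"

definition g :: "real \<Rightarrow> real" where
  "g a = (catK a)\<^sup>2 * deriv ball_radius a - a * tanh (ball_radius a)"

definition C0 :: real where
  "C0 = sigma_star * cosh sigma_star * ((sinh sigma_star)\<^sup>2 - 1) * (3 * (sinh sigma_star)\<^sup>2 - 2)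
          / (12 * (sinh sigma_star)\<^sup>2)"

end

theory Submission
  imports Defs
begin

text \<open>
  Put \<open>e = a - 1/2\<close> and replace the profile parameter \<open>s\<close> by \<open>u\<close> with
  \<open>sinh s = sqrt (e / (1 + 2 e)) sinh u\<close>. Then \<open>A\<^sup>2 = 1 + e cosh\<^sup>2 u\<close> and \<open>B = sqrt e cosh u\<close>, all
  factors \<open>sqrt e\<close> cancel, \<open>\<phi>\<close> becomes \<open>K\<close> times the integral of a kernel that is smooth in \<open>e\<close>, and
  the boundary equation becomes \<open>tanh \<phi> = K q\<close> with \<open>q = coth u / sqrt (1 + e + e cosh\<^sup>2 u)\<close>. Applying
  \<open>artanh\<close> and dividing by \<open>K\<close> gives \<open>F(e,u) = 0\<close> with \<open>F = \<phi> / K - artanh (K q) / K\<close>. Since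
  \<open>artanh y / y\<close> is a power series in \<open>y\<^sup>2\<close> and \<open>K\<^sup>2 = e (1 + e)\<close>, the function \<open>F\<close> extends across \<open>e = 0\<close>,
  where \<open>F(0,u) = u - coth u\<close> has the root \<open>\<sigma>\<^sub>*\<close> and \<open>F\<^sub>u = 1 + 1 / sinh\<^sup>2 u > 0\<close>. The implicit function theorem
  (\<open>implicit_function_rect\<close>) thus provides a differentiable curve \<open>U\<close> of roots with \<open>U(0) = \<sigma>\<^sub>*\<close>,
  and its derivative \<open>- F\<^sub>e / F\<^sub>u\<close> is once more differentiable at \<open>0\<close> (\<open>root_curve_second_derivative\<close>).

  For \<open>e > 0\<close> the root is the rescaled \<open>s\<^sub>0\<close>, and hyperbolic identities
  eliminate \<open>\<phi>\<close> from the radius (\<open>ball_radius_eq_arsinh\<close>):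
  \<open>H = cosh\<^sup>2 U / sqrt ((1 + e) (sinh\<^sup>2 U - e))\<close>. So \<open>H\<close> is the restriction of a function \<open>h\<close> of \<open>e\<close> near \<open>0\<close>
  whose derivative is itself differentiable at \<open>0\<close>; hence \<open>h' = C\<^sub>0 + O(e)\<close>, where the value \<open>h'(0)\<close> is
  computed from \<open>U'(0)\<close> (\<open>root_curve_deriv_at_0\<close>, \<open>Hprofile_deriv_0\<close>), and the mean value theorem yields
  the expansion of \<open>H\<close>. Finally \<open>g = K\<^sup>3 H' / cosh r\<close>, where \<open>K\<^sup>3 = (e (1 + e)) powr (3/2)\<close>; dividing by \<open>e powr (3/2)\<close> leaves
  a function differentiable at \<open>e = 0\<close> with value \<open>C\<^sub>0\<close> there, which gives the expansion of \<open>g\<close>.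
\<close>

section \<open>The implicit function theorem on rectangles\<close>

text \<open>Partial derivatives are recorded as explicit functions, because the second differentiation of
  the root curve needs formulas for them.\<close>

definition C1_on_rect ::
  "real set \<Rightarrow> real set \<Rightarrow> (real \<Rightarrow> real \<Rightarrow> real) \<Rightarrow> (real \<Rightarrow> real \<Rightarrow> real) \<Rightarrow> (real \<Rightarrow> real \<Rightarrow> real) \<Rightarrow> bool" where
  "C1_on_rect I J F Fx Fu \<longleftrightarrow>
     open I \<and> open J \<and> convex I \<and> convex J \<and>
     (\<forall>x\<in>I. \<forall>u\<in>J. ((\<lambda>x. F x u) has_real_derivative Fx x u) (at x)
                  \<and> (F x has_real_derivative Fu x u) (at u)) \<and>
     continuous_on (I \<times> J) (\<lambda>(x, u). Fx x u) \<and> continuous_on (I \<times> J) (\<lambda>(x, u). Fu x u)"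

lemma real_increment_eq:
  fixes f :: "real \<Rightarrow> real"
  assumes "convex I" "x \<in> I" "y \<in> I" "\<And>z. z \<in> I \<Longrightarrow> (f has_real_derivative f' z) (at z)"
  shows "\<exists>z\<in>I. \<bar>z - x\<bar> \<le> \<bar>y - x\<bar> \<and> f y - f x = f' z * (y - x)"
proof -
  have seg: "closed_segment x y \<subseteq> I"
    using assms by (simp add: closed_segment_subset)
  consider "x < y" | "x = y" | "y < x" by linarith
  then show ?thesis
  proof cases
    case 1
    have "\<exists>z. x < z \<and> z < y \<and> f y - f x = (y - x) * f' z"
      using seg 1 by (intro MVT2) (auto intro!: assms(4) simp: closed_segment_eq_real_ivl)
    then obtain z where "x < z" "z < y" "f y - f x = (y - x) * f' z" by blast
    with seg 1 show ?thesis
      by (intro bexI[of _ z]) (auto simp: closed_segment_eq_real_ivl algebra_simps)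
  next
    case 2
    then show ?thesis using assms(2) by force
  next
    case 3
    have "\<exists>z. y < z \<and> z < x \<and> f x - f y = (x - y) * f' z"
      using seg 3 by (intro MVT2) (auto intro!: assms(4) simp: closed_segment_eq_real_ivl)
    then obtain z where "y < z" "z < x" "f x - f y = (x - y) * f' z" by blast
    with seg 3 show ?thesis
      by (intro bexI[of _ z]) (auto simp: closed_segment_eq_real_ivl algebra_simps)
  qed
qed

text \<open>Moving first in \<open>x\<close> and then in \<open>u\<close>, the mean value theorem writes the increment of \<open>F\<close> along a
  curve as a combination whose coefficients tend to the partial derivatives. Since
  \<open>V\<close> is merely continuous here, the identity yields both the chain rule and the derivative of an implicitly
  defined function.\<close>

lemma C1_on_rect_increment:
  assumes F: "C1_on_rect I J F Fx Fu" and x: "x \<in> I" "V x \<in> J" and V: "isCont V x"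
  obtains p q where "p \<midarrow>x\<rightarrow> Fx x (V x)" "q \<midarrow>x\<rightarrow> Fu x (V x)"
    "\<forall>\<^sub>F y in at x. F y (V y) - F x (V x) = p y * (y - x) + q y * (V y - V x)"
proof -
  have I: "open I" "convex I" and J: "open J" "convex J"
    and dx: "\<And>x u. x \<in> I \<Longrightarrow> u \<in> J \<Longrightarrow> ((\<lambda>x. F x u) has_real_derivative Fx x u) (at x)"
    and du: "\<And>x u. x \<in> I \<Longrightarrow> u \<in> J \<Longrightarrow> (F x has_real_derivative Fu x u) (at u)"
    and cx: "continuous_on (I \<times> J) (\<lambda>(x, u). Fx x u)"
    and cu: "continuous_on (I \<times> J) (\<lambda>(x, u). Fu x u)"
    using F by (auto simp: C1_on_rect_def)
  have "\<exists>\<xi>\<in>I. \<bar>\<xi> - x\<bar> \<le> \<bar>y - x\<bar> \<and> F y (V y) - F x (V y) = Fx \<xi> (V y) * (y - x)"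
    if "y \<in> I" "V y \<in> J" for y
    using real_increment_eq[OF I(2) x(1) that(1), of "\<lambda>x. F x (V y)" "\<lambda>x. Fx x (V y)"] dx that by blast
  then obtain \<xi> where \<xi>: "\<And>y. y \<in> I \<Longrightarrow> V y \<in> J \<Longrightarrow> \<xi> y \<in> I \<and> \<bar>\<xi> y - x\<bar> \<le> \<bar>y - x\<bar> \<and>
      F y (V y) - F x (V y) = Fx (\<xi> y) (V y) * (y - x)"
    by metis
  have "\<exists>\<eta>\<in>J. \<bar>\<eta> - V x\<bar> \<le> \<bar>V y - V x\<bar> \<and> F x (V y) - F x (V x) = Fu x \<eta> * (V y - V x)"
    if "V y \<in> J" for y
    using real_increment_eq[OF J(2) x(2) that, of "F x" "Fu x"] du x by blast
  then obtain \<eta> where \<eta>: "\<And>y. V y \<in> J \<Longrightarrow> \<eta> y \<in> J \<and> \<bar>\<eta> y - V x\<bar> \<le> \<bar>V y - V x\<bar> \<and>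
      F x (V y) - F x (V x) = Fu x (\<eta> y) * (V y - V x)"
    by metis
  have V': "V \<midarrow>x\<rightarrow> V x" using V by (simp add: isCont_def)
  have evI: "\<forall>\<^sub>F y in at x. y \<in> I"
    using I x by (intro eventually_at_in_open') auto
  have evJ: "\<forall>\<^sub>F y in at x. V y \<in> J"
    using V' J(1) x(2) by (rule topological_tendstoD)
  have \<xi>lim: "\<xi> \<midarrow>x\<rightarrow> x"
  proof (rule LIM_zero_cancel[OF Lim_transform_bound[where g = "\<lambda>y. y - x"]])
    show "\<forall>\<^sub>F y in at x. norm (\<xi> y - x) \<le> norm (y - x)"
      using evI evJ by eventually_elim (use \<xi> in auto)
    show "(\<lambda>y. y - x) \<midarrow>x\<rightarrow> 0" by (rule LIM_zero) (rule tendsto_ident_at)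
  qed
  have \<eta>lim: "\<eta> \<midarrow>x\<rightarrow> V x"
  proof (rule LIM_zero_cancel[OF Lim_transform_bound[where g = "\<lambda>y. V y - V x"]])
    show "\<forall>\<^sub>F y in at x. norm (\<eta> y - V x) \<le> norm (V y - V x)"
      using evJ by eventually_elim (use \<eta> in auto)
    show "(\<lambda>y. V y - V x) \<midarrow>x\<rightarrow> 0" by (rule LIM_zero) (rule V')
  qed
  have "isCont (\<lambda>(x, u). Fx x u) (x, V x)" "isCont (\<lambda>(x, u). Fu x u) (x, V x)"
    using cx cu x I J by (auto simp: continuous_on_eq_continuous_at open_Times)
  note cont = this[THEN isCont_tendsto_compose]
  show thesis
  proof
    show "(\<lambda>y. Fx (\<xi> y) (V y)) \<midarrow>x\<rightarrow> Fx x (V x)"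
      using cont(1)[OF tendsto_Pair[OF \<xi>lim V']] by simp
    show "(\<lambda>y. Fu x (\<eta> y)) \<midarrow>x\<rightarrow> Fu x (V x)"
      using cont(2)[OF tendsto_Pair[OF tendsto_const \<eta>lim]] by simp
    show "\<forall>\<^sub>F y in at x. F y (V y) - F x (V x) = Fx (\<xi> y) (V y) * (y - x) + Fu x (\<eta> y) * (V y - V x)"
      using evI evJ
    proof eventually_elim
      case (elim y)
      show ?case using \<xi>[OF elim] \<eta>[OF elim(2)] by linarith
    qed
  qed
qed

lemma C1_on_rect_chain:
  assumes F: "C1_on_rect I J F Fx Fu" and x: "x \<in> I" "V x \<in> J"
    and V: "(V has_real_derivative V') (at x)"
  shows "((\<lambda>x. F x (V x)) has_real_derivative Fx x (V x) + Fu x (V x) * V') (at x)"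
proof -
  obtain p q where pq: "p \<midarrow>x\<rightarrow> Fx x (V x)" "q \<midarrow>x\<rightarrow> Fu x (V x)"
    and ev: "\<forall>\<^sub>F y in at x. F y (V y) - F x (V x) = p y * (y - x) + q y * (V y - V x)"
    using C1_on_rect_increment[OF F x DERIV_isCont[OF V]] .
  have "(\<lambda>y. p y + q y * ((V y - V x) / (y - x))) \<midarrow>x\<rightarrow> Fx x (V x) + Fu x (V x) * V'"
    using V by (intro tendsto_intros pq) (simp add: has_field_derivative_iff)
  moreover have "\<forall>\<^sub>F y in at x. p y + q y * ((V y - V x) / (y - x)) = (F y (V y) - F x (V x)) / (y - x)"
    using ev eventually_neq_at_within[of x x UNIV]
    by eventually_elim (auto simp: field_simps)
  ultimately show ?thesis
    by (simp add: has_field_derivative_iff tendsto_cong)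
qed

lemma C1_on_rect_continuous:
  assumes F: "C1_on_rect I J F Fx Fu" and x: "x \<in> I" and u: "u \<in> J"
  shows "isCont (\<lambda>x. F x u) x" "isCont (F x) u"
  using assms by (auto simp: C1_on_rect_def intro: DERIV_isCont)

lemma C1_on_rect_diff:
  assumes "C1_on_rect I J F1 Fx1 Fu1" "C1_on_rect I J F2 Fx2 Fu2"
  shows "C1_on_rect I J (\<lambda>x u. F1 x u - F2 x u) (\<lambda>x u. Fx1 x u - Fx2 x u) (\<lambda>x u. Fu1 x u - Fu2 x u)"
  using assms unfolding C1_on_rect_def split_beta
  by (auto intro!: DERIV_diff continuous_on_diff)

text \<open>Near the base point \<open>F\<close> is strictly increasing in \<open>u\<close>, so the intermediate value theorem gives a
  unique root; the sign of \<open>F\<close> just above and below a root is stable in \<open>x\<close>, which makes the root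
  continuous; and dividing the increment identity along the root curve, where \<open>F\<close> vanishes, by
  \<open>y - x\<close> gives the derivative.\<close>

theorem implicit_function_rect:
  assumes F: "C1_on_rect I J F Fx Fu" and x0: "x0 \<in> I" "u0 \<in> J"
    and zero: "F x0 u0 = 0" and pos: "Fu x0 u0 > 0"
  obtains \<delta> V where "\<delta> > 0" "ball x0 \<delta> \<subseteq> I" "V x0 = u0"
    "\<And>x. x \<in> ball x0 \<delta> \<Longrightarrow> V x \<in> J \<and> F x (V x) = 0 \<and> Fu x (V x) > 0 \<and>
       (V has_real_derivative - Fx x (V x) / Fu x (V x)) (at x)"
proof -
  have I: "open I" "convex I" and J: "open J" "convex J"
    and dx: "\<And>x u. x \<in> I \<Longrightarrow> u \<in> J \<Longrightarrow> ((\<lambda>x. F x u) has_real_derivative Fx x u) (at x)"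
    and du: "\<And>x u. x \<in> I \<Longrightarrow> u \<in> J \<Longrightarrow> (F x has_real_derivative Fu x u) (at u)"
    and cu: "continuous_on (I \<times> J) (\<lambda>(x, u). Fu x u)"
    using F by (auto simp: C1_on_rect_def)
  note cF = C1_on_rect_continuous[OF F]
  have "isCont (\<lambda>(x, u). Fu x u) (x0, u0)"
    using cu x0 I J by (auto simp: continuous_on_eq_continuous_at open_Times)
  then have "\<forall>\<^sub>F z in nhds (x0, u0). 0 < (\<lambda>(x, u). Fu x u) z"
    unfolding isCont_def tendsto_at_iff_tendsto_nhds by (rule order_tendstoD) (simp add: pos)
  moreover have "\<forall>\<^sub>F z in nhds (x0, u0). z \<in> I \<times> J"
    using x0 I J by (intro eventually_nhds_in_open) (auto simp: open_Times)
  ultimately have "\<forall>\<^sub>F z in nhds (x0, u0). z \<in> I \<times> J \<and> 0 < (\<lambda>(x, u). Fu x u) z"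
    by eventually_elim auto
  then obtain P Q where P: "\<forall>\<^sub>F x in nhds x0. P x" and Q: "\<forall>\<^sub>F u in nhds u0. Q u"
    and PQ: "\<And>x u. P x \<Longrightarrow> Q u \<Longrightarrow> x \<in> I \<and> u \<in> J \<and> 0 < Fu x u"
    unfolding nhds_prod eventually_prod_filter by auto
  obtain \<epsilon> where \<epsilon>: "\<epsilon> > 0" and Qe: "\<And>u. u \<in> {u0-\<epsilon>..u0+\<epsilon>} \<Longrightarrow> Q u"
  proof -
    from Q obtain e where "e > 0" "\<And>u. dist u u0 < e \<Longrightarrow> Q u"
      unfolding eventually_nhds_metric by blast
    then show thesis by (intro that[of "e/2"]) (auto simp: dist_real_def)
  qed
  have mono: "F x u < F x w" if "P x" "u0 - \<epsilon> \<le> u" "u < w" "w \<le> u0 + \<epsilon>" for x u w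
  proof (rule DERIV_pos_imp_increasing[OF that(3)])
    fix z assume "u \<le> z" "z \<le> w"
    then have "x \<in> I \<and> z \<in> J \<and> 0 < Fu x z" using that by (intro PQ Qe) auto
    then show "\<exists>y. (F x has_real_derivative y) (at z) \<and> 0 < y" using du by blast
  qed
  have Px0: "P x0" using P by (rule eventually_nhds_x_imp_x)
  have inJ: "u \<in> J" if "u \<in> {u0-\<epsilon>..u0+\<epsilon>}" for u using PQ[OF Px0 Qe[OF that]] by simp
  \<comment> \<open>A sign change of \<open>F\<close> between two heights persists for nearby \<open>x\<close>; this traps the root.\<close>
  have sgn: "\<forall>\<^sub>F y in nhds x. P y \<longrightarrow> F y u < 0 \<and> F y w > 0"
    if "x \<in> I" "F x v = 0" "P x" "u0-\<epsilon> \<le> u" "u < v" "v < w" "w \<le> u0+\<epsilon>" for x u v w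
  proof -
    have "F x u < 0" "F x w > 0" using mono[of x u v] mono[of x v w] that by auto
    moreover have "isCont (\<lambda>x. F x u) x" "isCont (\<lambda>x. F x w) x"
      using cF[OF that(1) inJ[of u]] cF[OF that(1) inJ[of w]] that by auto
    then have "((\<lambda>x. F x u) \<longlongrightarrow> F x u) (nhds x)" "((\<lambda>x. F x w) \<longlongrightarrow> F x w) (nhds x)"
      using tendsto_at_iff_tendsto_nhds[of "\<lambda>x. F x u" x]
        tendsto_at_iff_tendsto_nhds[of "\<lambda>x. F x w" x] by (simp_all add: isCont_def)
    ultimately have "\<forall>\<^sub>F y in nhds x. F y u < 0" and "\<forall>\<^sub>F y in nhds x. F y w > 0"
      by (auto dest: order_tendstoD)
    then show ?thesis by eventually_elim auto
  qed
  have "\<forall>\<^sub>F y in nhds x0. P y \<and> F y (u0-\<epsilon>) < 0 \<and> F y (u0+\<epsilon>) > 0"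
    using sgn[of x0 u0 "u0-\<epsilon>" "u0+\<epsilon>"] P zero \<epsilon> Px0 x0
    by (auto elim: eventually_elim2)
  then obtain \<delta> where \<delta>: "\<delta> > 0"
    and near: "\<And>y. y \<in> ball x0 \<delta> \<Longrightarrow> P y \<and> F y (u0-\<epsilon>) < 0 \<and> F y (u0+\<epsilon>) > 0"
    unfolding eventually_nhds_metric by (auto simp: dist_commute)
  have sub: "ball x0 \<delta> \<subseteq> I" using near PQ[OF _ Qe[of u0]] \<epsilon> by auto
  have "\<exists>v. v \<in> {u0-\<epsilon><..<u0+\<epsilon>} \<and> F x v = 0" if "x \<in> ball x0 \<delta>" for x
  proof -
    have "\<exists>v\<ge>u0-\<epsilon>. v \<le> u0+\<epsilon> \<and> F x v = 0"
      using near[OF that] sub that \<epsilon> inJ by (intro IVT) (auto intro!: cF less_imp_le)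
    then obtain v where "u0-\<epsilon> \<le> v" "v \<le> u0+\<epsilon>" "F x v = 0" by blast
    with near[OF that] show ?thesis
      by (intro exI[of _ v]) (auto simp: less_le)
  qed
  then obtain V where V: "\<And>x. x \<in> ball x0 \<delta> \<Longrightarrow> V x \<in> {u0-\<epsilon><..<u0+\<epsilon>} \<and> F x (V x) = 0"
    by metis
  have uniq: "v = V x" if "x \<in> ball x0 \<delta>" "v \<in> {u0-\<epsilon>..u0+\<epsilon>}" "F x v = 0" for x v
    using mono[of x v "V x"] mono[of x "V x" v] V[OF that(1)] near[OF that(1)] that
    by (cases v "V x" rule: linorder_cases) auto
  have Vx: "V x \<in> J \<and> F x (V x) = 0 \<and> Fu x (V x) > 0" if "x \<in> ball x0 \<delta>" for x
    using V[OF that] near[OF that] PQ[of x "V x"] Qe[of "V x"] by auto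
  have "isCont V x" if x: "x \<in> ball x0 \<delta>" for x
    unfolding isCont_def
  proof (rule tendstoI)
    fix e :: real assume "e > 0"
    define r where "r = min (e/2) (min (V x - (u0-\<epsilon>)) (u0+\<epsilon> - V x))"
    have r: "r > 0" "r < e" "u0-\<epsilon> \<le> V x - r" "V x + r \<le> u0+\<epsilon>"
      using V[OF x] \<open>e > 0\<close> by (auto simp: r_def)
    have "\<forall>\<^sub>F y in nhds x. P y \<longrightarrow> F y (V x - r) < 0 \<and> F y (V x + r) > 0"
      using r V[OF x] near[OF x] sub x by (intro sgn[where v = "V x"]) auto
    moreover have "\<forall>\<^sub>F y in nhds x. y \<in> ball x0 \<delta>"
      using x by (intro eventually_nhds_in_open) auto
    ultimately have "\<forall>\<^sub>F y in nhds x. dist (V y) (V x) < e"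
    proof eventually_elim
      case (elim y)
      then have y: "P y" "F y (V x - r) < 0" "F y (V x + r) > 0" using near by auto
      have "V x - r < V y"
        using mono[OF y(1), of "V y" "V x - r"] V[OF elim(2)] y r V[OF x]
        by (cases "V y" "V x - r" rule: linorder_cases) auto
      moreover have "V y < V x + r"
        using mono[OF y(1), of "V x + r" "V y"] V[OF elim(2)] y r V[OF x]
        by (cases "V y" "V x + r" rule: linorder_cases) auto
      ultimately show ?case using r by (auto simp: dist_real_def)
    qed
    then show "\<forall>\<^sub>F y in at x. dist (V y) (V x) < e"
      by (simp add: eventually_nhds_conv_at)
  qed
  note contV = this
  have "(V has_real_derivative - Fx x (V x) / Fu x (V x)) (at x)" if x: "x \<in> ball x0 \<delta>" for x
  proof -
    obtain p q where pq: "p \<midarrow>x\<rightarrow> Fx x (V x)" "q \<midarrow>x\<rightarrow> Fu x (V x)"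
      and ev: "\<forall>\<^sub>F y in at x. F y (V y) - F x (V x) = p y * (y - x) + q y * (V y - V x)"
      using C1_on_rect_increment[OF F _ _ contV[OF x]] Vx[OF x] sub x by blast
    have "(\<lambda>y. - p y / q y) \<midarrow>x\<rightarrow> - Fx x (V x) / Fu x (V x)"
      using Vx[OF x] by (intro tendsto_intros pq) auto
    moreover have "\<forall>\<^sub>F y in at x. q y > 0"
      using pq(2) Vx[OF x] by (auto intro: order_tendstoD)
    moreover have "\<forall>\<^sub>F y in at x. y \<in> ball x0 \<delta>"
      using x by (intro eventually_at_in_open') auto
    with ev have "\<forall>\<^sub>F y in at x. p y * (y - x) + q y * (V y - V x) = 0"
      by eventually_elim (use Vx x in auto)
    moreover have "\<forall>\<^sub>F y in at x. y \<noteq> x" by (rule eventually_neq_at_within)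
    ultimately have lim: "(\<lambda>y. - p y / q y) \<midarrow>x\<rightarrow> - Fx x (V x) / Fu x (V x)"
      and evs: "\<forall>\<^sub>F y in at x. q y > 0"
        "\<forall>\<^sub>F y in at x. p y * (y - x) + q y * (V y - V x) = 0" "\<forall>\<^sub>F y in at x. y \<noteq> x"
      by auto
    from evs have "\<forall>\<^sub>F y in at x. - p y / q y = (V y - V x) / (y - x)"
    proof eventually_elim
      case (elim y)
      have "- p y / q y - (V y - V x) / (y - x) = - (p y * (y - x) + q y * (V y - V x)) / (q y * (y - x))"
        using elim by (simp add: field_simps)
      also have "\<dots> = 0" using elim by simp
      finally show ?case by simp
    qed
    with lim show ?thesis
      by (simp add: has_field_derivative_iff tendsto_cong)
  qed
  moreover have "V x0 = u0" using uniq[of x0 u0] zero \<delta> \<epsilon> by auto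
  ultimately show thesis using that[OF \<delta> sub] Vx by blast
qed

section \<open>Integrals depending on a parameter\<close>

text \<open>On a fixed interval of integration, joint continuity of a parameter integral is immediate, also
  when the upper limit is one of the parameters.\<close>

lemma integral_stretch_unit:
  fixes f :: "real \<Rightarrow> real"
  assumes "0 \<le> u" "continuous_on {0..u} f"
  shows "integral {0..u} f = integral {0..1} (\<lambda>t. u * f (u * t))"
proof -
  have "((\<lambda>t. u *\<^sub>R f (u * t)) has_integral integral {u*0..u*1} f) {0..1}"
  proof (rule has_integral_substitution[where c = 0 and d = u])
    show "(*) u ` {0..1} \<subseteq> {0..u}"
      using assms(1) by (auto intro: mult_left_le)
  qed (use assms in \<open>auto intro!: derivative_eq_intros\<close>)
  from integral_unique[OF this] show ?thesis by simp
qed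

lemma C1_on_rect_integral:
  fixes m n :: "real \<Rightarrow> real \<Rightarrow> real"
  assumes I: "open I" "convex I" and c: "0 \<le> c"
    and deriv: "\<And>x v. x \<in> I \<Longrightarrow> v \<in> {0..b} \<Longrightarrow> ((\<lambda>x. m x v) has_real_derivative n x v) (at x)"
    and contm: "continuous_on (I \<times> {0..b}) (\<lambda>(x, v). m x v)"
    and contn: "continuous_on (I \<times> {0..b}) (\<lambda>(x, v). n x v)"
  shows "C1_on_rect I {c<..<b} (\<lambda>x u. integral {0..u} (m x)) (\<lambda>x u. integral {0..u} (n x)) m"
proof -
  have m: "continuous_on {0..u} (m x)" if "x \<in> I" "u \<le> b" for x u
  proof -
    have pair: "continuous_on {0..u} (Pair x)"
      by (rule continuous_on_Pair[OF continuous_on_const continuous_on_id])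
    have sub: "Pair x ` {0..u} \<subseteq> I \<times> {0..b}" using that by auto
    then show ?thesis
      using continuous_on_compose2[OF contm pair sub] by simp
  qed
  have n: "continuous_on {0..u} (n x)" if "x \<in> I" "u \<le> b" for x u
  proof -
    have pair: "continuous_on {0..u} (Pair x)"
      by (rule continuous_on_Pair[OF continuous_on_const continuous_on_id])
    have sub: "Pair x ` {0..u} \<subseteq> I \<times> {0..b}" using that by auto
    then show ?thesis
      using continuous_on_compose2[OF contn pair sub] by simp
  qed
  have 1: "((\<lambda>x. integral {0..u} (m x)) has_real_derivative integral {0..u} (n x)) (at x)"
    if "x \<in> I" "u \<in> {c<..<b}" for x u
  proof -
    have "((\<lambda>x. integral (cbox 0 u) (m x)) has_real_derivative integral (cbox 0 u) (n x)) (at x within I)"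
    proof (rule leibniz_rule_field_derivative)
      show "((\<lambda>x. m x v) has_real_derivative n y v) (at y within I)"
        if "y \<in> I" "v \<in> cbox 0 u" for y v
        by (rule deriv[THEN has_field_derivative_at_within]) (use that \<open>u \<in> _\<close> in auto)
      show "m y integrable_on cbox 0 u" if "y \<in> I" for y
        using m[OF that, of u] \<open>u \<in> _\<close> by (simp add: integrable_continuous_real)
      show "continuous_on (I \<times> cbox 0 u) (\<lambda>(x, t). n x t)"
        by (rule continuous_on_subset[OF contn]) (use that in auto)
    qed (use that I in simp_all)
    then show ?thesis unfolding at_within_open[OF that(1) I(1)] by simp
  qed
  have 2: "((\<lambda>u. integral {0..u} (m x)) has_real_derivative m x u) (at u)"
    if "x \<in> I" "u \<in> {c<..<b}" for x u
  proof -
    have "((\<lambda>u. integral {0..u} (m x)) has_real_derivative m x u) (at u within {0..b})"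
      using m[of x b] that c by (intro integral_has_real_derivative) auto
    moreover have "at u within {0..b} = at u"
      using that c by (intro at_within_interior) (auto simp: interior_atLeastAtMost_real)
    ultimately show ?thesis by simp
  qed
  have 3: "continuous_on (I \<times> {c<..<b}) (\<lambda>(x, u). integral {0..u} (n x))"
  proof -
    have "continuous_on (I \<times> {c<..<b}) (\<lambda>p. integral (cbox 0 1) (\<lambda>t. snd p * n (fst p) (snd p * t)))"
    proof (rule integral_continuous_on_param)
      have "(\<lambda>z. (fst (fst z), snd (fst z) * snd z)) ` ((I \<times> {c<..<b}) \<times> cbox 0 1) \<subseteq> I \<times> {0..b}"
      proof -
        have "u * t \<le> b" if "0 \<le> u" "u < b" "0 \<le> t" "t \<le> 1" for u t :: real
          using mult_left_le[of t u] that by linarith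
        then show ?thesis using c by (force simp: image_subset_iff)
      qed
      note sub = this
      have "continuous_on ((I \<times> {c<..<b}) \<times> cbox 0 1)
          (\<lambda>z. (\<lambda>(x, v). n x v) (fst (fst z), snd (fst z) * snd z))"
        by (rule continuous_on_compose2[OF contn _ sub]) (intro continuous_intros)
      then show "continuous_on ((I \<times> {c<..<b}) \<times> cbox 0 1) (\<lambda>(p, t). snd p * n (fst p) (snd p * t))"
        unfolding split_beta fst_conv snd_conv by (intro continuous_intros)
    qed
    moreover have "integral (cbox 0 1) (\<lambda>t. snd p * n (fst p) (snd p * t)) = (\<lambda>(x, u). integral {0..u} (n x)) p"
      if "p \<in> I \<times> {c<..<b}" for p
    proof (cases p)
      case (Pair x u)
      then show ?thesis
        using integral_stretch_unit[of u "n x"] n[of x u] that c by simp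
    qed
    ultimately show ?thesis by (simp cong: continuous_on_cong)
  qed
  have 4: "continuous_on (I \<times> {c<..<b}) (\<lambda>(x, u). m x u)"
    by (rule continuous_on_subset[OF contm]) (use c in auto)
  show ?thesis using 1 2 3 4 I by (simp add: C1_on_rect_def)
qed

section \<open>The power series of artanh\<close>

definition artanh_coeff :: "nat \<Rightarrow> real" where
  "artanh_coeff n = 1 / of_nat (2 * n + 1)"

text \<open>The even power series with \<open>artanh y = y * artanhc (y\<^sup>2)\<close>. For \<open>y = K q\<close> its argument involves
  \<open>K\<^sup>2 = e (1 + e)\<close> instead of \<open>K\<close>, which removes the square root singularity at \<open>e = 0\<close>.\<close>

definition artanhc :: "real \<Rightarrow> real" where
  "artanhc x = (\<Sum>n. artanh_coeff n * x ^ n)"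

definition artanhc' :: "real \<Rightarrow> real" where
  "artanhc' x = (\<Sum>n. diffs artanh_coeff n * x ^ n)"

lemma summable_artanh_coeff:
  assumes "\<bar>x\<bar> < 1" shows "summable (\<lambda>n. artanh_coeff n * x ^ n)"
proof (rule summable_comparison_test')
  show "summable (\<lambda>n. \<bar>x\<bar> ^ n)" using assms by (simp add: summable_geometric)
  show "norm (artanh_coeff n * x ^ n) \<le> \<bar>x\<bar> ^ n" for n
    using mult_right_mono[of "artanh_coeff n" 1 "\<bar>x\<bar> ^ n"]
    by (simp add: artanh_coeff_def abs_mult power_abs)
qed

lemma DERIV_artanhc: "\<bar>x\<bar> < 1 \<Longrightarrow> (artanhc has_real_derivative artanhc' x) (at x)"
  unfolding artanhc_def artanhc'_def
  by (rule termdiffs_strong'[where K = 1]) (auto intro: summable_artanh_coeff)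

lemma DERIV_artanhc': "\<bar>x\<bar> < 1 \<Longrightarrow> \<exists>D. (artanhc' has_real_derivative D) (at x)"
  unfolding artanhc'_def
  by (rule exI, rule termdiffs_strong'[where K = 1], rule termdiff_converges[where K = 1])
    (simp_all add: summable_artanh_coeff)

lemma continuous_on_artanhc:
  "continuous_on {-1<..<1} artanhc" "continuous_on {-1<..<1} artanhc'"
proof -
  have "isCont artanhc x" "isCont artanhc' x" if "x \<in> {-1<..<1}" for x
    using DERIV_artanhc[of x] DERIV_artanhc'[of x] that by (auto simp: abs_less_iff intro: DERIV_isCont)
  then show "continuous_on {-1<..<1} artanhc" "continuous_on {-1<..<1} artanhc'"
    by (auto intro: continuous_at_imp_continuous_on)
qed

lemma artanhc_0 [simp]: "artanhc 0 = 1"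
  using powser_zero[of artanh_coeff] by (simp add: artanhc_def artanh_coeff_def)

lemma artanhc'_0 [simp]: "artanhc' 0 = 1 / 3"
  using powser_zero[of "diffs artanh_coeff"] by (simp add: artanhc'_def diffs_def artanh_coeff_def)

lemma artanh_eq_artanhc:
  assumes "\<bar>y\<bar> < 1" shows "artanh y = y * artanhc (y\<^sup>2)"
proof -
  have eq: "((1 + y) / (1 - y) - 1) / ((1 + y) / (1 - y) + 1) = y"
    using assms by (simp add: field_simps)
  have pos: "(1 + y) / (1 - y) > 0"
    using assms by (intro divide_pos_pos) auto
  have "(\<lambda>n. 2 * y ^ (2 * n + 1) / of_nat (2 * n + 1)) sums ln ((1 + y) / (1 - y))"
    using ln_series_quadratic[of "(1 + y) / (1 - y)", unfolded eq] pos by blast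
  moreover have "2 * y ^ (2 * n + 1) / of_nat (2 * n + 1) = 2 * y * (artanh_coeff n * (y\<^sup>2) ^ n)" for n
    by (simp add: artanh_coeff_def power_mult)
  ultimately have "(\<lambda>n. 2 * y * (artanh_coeff n * (y\<^sup>2) ^ n)) sums ln ((1 + y) / (1 - y))"
    by (simp only:)
  moreover have "(\<lambda>n. 2 * y * (artanh_coeff n * (y\<^sup>2) ^ n)) sums (2 * y * artanhc (y\<^sup>2))"
    unfolding artanhc_def
    by (intro sums_mult summable_sums summable_artanh_coeff) (use assms in \<open>simp add: abs_square_less_1\<close>)
  ultimately have "ln ((1 + y) / (1 - y)) = 2 * y * artanhc (y\<^sup>2)" by (rule sums_unique2)
  then show ?thesis by (simp add: artanh_def)
qed

lemma tanh_artanh_real: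
  fixes x :: real
  assumes "\<bar>x\<bar> < 1" shows "tanh (artanh x) = x"
proof -
  have pos: "(1 + x) / (1 - x) > 0" using assms by (intro divide_pos_pos) auto
  have "exp (- 2 * artanh x) = inverse ((1 + x) / (1 - x))"
    using pos by (simp add: artanh_def exp_minus)
  also have "\<dots> = (1 - x) / (1 + x)" by (simp add: inverse_eq_divide)
  finally have "tanh (artanh x) = (1 - (1 - x) / (1 + x)) / (1 + (1 - x) / (1 + x))"
    unfolding tanh_real_altdef by (rule arg_cong)
  also have "\<dots> = x" using assms by (simp add: field_simps)
  finally show ?thesis .
qed

section \<open>The rescaled integrand\<close>

text \<open>Here \<open>e\<close> stands for \<open>a - 1/2\<close>. Negative values are included so that \<open>e = 0\<close> becomes an interior
  point; the bound 1/100 keeps all radicands away from zero for heights up to 2.\<close>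

definition param_dom :: "real set" where "param_dom = {-1/100<..<1/100}"

text \<open>The range of the rescaled variable \<open>u\<close>, given by \<open>sinh u = sqrt ((1 + 2 e) / e) sinh s\<close>; it contains
  \<open>\<sigma>\<^sub>*\<close>, the limiting root.\<close>

definition height_dom :: "real set" where "height_dom = {1<..<2}"

text \<open>In the variable \<open>u\<close> this is \<open>(1 + 2 e) (cosh s)\<^sup>2\<close>.\<close>

definition radC :: "real \<Rightarrow> real \<Rightarrow> real" where
  "radC e v = 1 + e + e * (cosh v)\<^sup>2"

text \<open>In the variable \<open>u\<close> this is \<open>A(s)\<^sup>2\<close>.\<close>

definition radA :: "real \<Rightarrow> real \<Rightarrow> real" where
  "radA e v = 1 + e * (cosh v)\<^sup>2"

text \<open>The integrand of \<open>\<phi> / K\<close> with respect to \<open>u\<close>: the factor \<open>sqrt e\<close> of \<open>ds/du\<close> cancels the one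
  in \<open>B\<close>, and what is left is smooth across \<open>e = 0\<close>. The next two functions are its first two
  derivatives in \<open>e\<close>.\<close>

definition phi_ker :: "real \<Rightarrow> real \<Rightarrow> real" where
  "phi_ker e v = 1 / (radA e v * sqrt (radC e v))"

definition phi_ker_e :: "real \<Rightarrow> real \<Rightarrow> real" where
  "phi_ker_e e v = - (cosh v)\<^sup>2 / ((radA e v)\<^sup>2 * sqrt (radC e v))
     - (1 + (cosh v)\<^sup>2) / (2 * radA e v * radC e v * sqrt (radC e v))"

definition phi_ker_ee :: "real \<Rightarrow> real \<Rightarrow> real" where
  "phi_ker_ee e v = 2 * (cosh v)^4 / ((radA e v)^3 * sqrt (radC e v))
     + (cosh v)\<^sup>2 * (1 + (cosh v)\<^sup>2) / ((radA e v)\<^sup>2 * radC e v * sqrt (radC e v))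
     + 3 * (1 + (cosh v)\<^sup>2)\<^sup>2 / (4 * radA e v * (radC e v)\<^sup>2 * sqrt (radC e v))"

lemma cosh_sq_le_25:
  fixes v :: real
  assumes "0 \<le> v" "v \<le> 2" shows "(cosh v)\<^sup>2 \<le> 25"
proof -
  have "exp (2::real) = exp 1 * exp 1" by (simp add: mult_exp_exp)
  also have "\<dots> \<le> 3 * 3" using exp_le by (intro mult_mono) auto
  finally have "exp (2::real) \<le> 9" by simp
  moreover have "exp v \<le> exp 2" using assms by simp
  ultimately have "exp v \<le> 9" by linarith
  moreover have "exp (-v) \<le> 1" using assms by simp
  ultimately have "cosh v \<le> (9 + 1) / 2"
    unfolding cosh_field_def by (intro divide_right_mono add_mono) simp_all
  then have "cosh v \<le> 5" by simp
  then have "(cosh v)\<^sup>2 \<le> 5\<^sup>2" by (intro power_mono) (auto simp: cosh_real_nonneg)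
  then show ?thesis by simp
qed

lemma sinh_sq_gt_1:
  fixes u :: real assumes "u > 1" shows "(sinh u)\<^sup>2 > 1" "sinh u > 1"
proof -
  have "sinh 0 - 0 \<le> sinh u - u"
  proof (rule DERIV_nonneg_imp_nondecreasing[where f = "\<lambda>x. sinh x - x"])
    show "\<exists>y. ((\<lambda>x::real. sinh x - x) has_real_derivative y) (at x) \<and> y \<ge> 0" for x
      by (intro exI[of _ "cosh x - 1"]) (auto intro!: derivative_eq_intros simp: cosh_real_ge_1)
  qed (use assms in simp)
  then show "sinh u > 1" using assms by auto
  then show "(sinh u)\<^sup>2 > 1" by (simp add: one_less_power)
qed

lemma rad_ge_half:
  assumes "e \<in> param_dom" "0 \<le> v" "v \<le> 2"
  shows "radA e v \<ge> 1/2" "radC e v \<ge> 1/2"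
proof -
  have "\<bar>e * (cosh v)\<^sup>2\<bar> \<le> 1/100 * 25"
    unfolding abs_mult using assms cosh_sq_le_25[of v] by (intro mult_mono) (auto simp: param_dom_def)
  then show "radA e v \<ge> 1/2" "radC e v \<ge> 1/2"
    using assms by (auto simp: radA_def radC_def param_dom_def)
qed

lemma rad_pos:
  assumes "e \<in> param_dom" "0 \<le> v" "v \<le> 2"
  shows "radA e v > 0" "radC e v > 0"
  using rad_ge_half[OF assms] by auto

lemma sinh_pos_height_dom: "u \<in> height_dom \<Longrightarrow> sinh u > 0"
  by (auto simp: height_dom_def)

lemma rad_pos_dom:
  assumes "e \<in> param_dom" "u \<in> height_dom"
  shows "radA e u > 0" "radC e u > 0"
  using assms rad_pos[of e u] by (auto simp: height_dom_def)

lemma rad_0 [simp]: "radC 0 v = 1" "radA 0 v = 1"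
  by (simp_all add: radC_def radA_def)

lemma rad_pos_right: "e > 0 \<Longrightarrow> radA e v > 0" "e > 0 \<Longrightarrow> radC e v > 0"
  by (simp_all add: radA_def radC_def add_pos_nonneg)

lemma continuous_on_rad [continuous_intros]:
  assumes "continuous_on S a" "continuous_on S b"
  shows "continuous_on S (\<lambda>x. radA (a x) (b x))" "continuous_on S (\<lambda>x. radC (a x) (b x))"
  unfolding radA_def radC_def by (intro continuous_intros assms)+

lemma DERIV_rad_param:
  shows "((\<lambda>e. radA e v) has_real_derivative (cosh v)\<^sup>2) (at e)"
    "((\<lambda>e. radC e v) has_real_derivative 1 + (cosh v)\<^sup>2) (at e)"
  unfolding radA_def radC_def by (auto intro!: derivative_eq_intros)

lemma DERIV_inverse_sqrt_radC:
  assumes "radC e v > 0"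
  shows "((\<lambda>e. 1 / sqrt (radC e v)) has_real_derivative
     - ((1 + (cosh v)\<^sup>2) / (2 * radC e v * sqrt (radC e v)))) (at e)"
  using assms by (auto intro!: derivative_eq_intros DERIV_rad_param simp: field_simps)

lemma DERIV_inverse_radA:
  assumes "radA e v > 0"
  shows "((\<lambda>e. 1 / radA e v) has_real_derivative - (cosh v)\<^sup>2 / (radA e v)\<^sup>2) (at e)"
  using assms by (auto intro!: derivative_eq_intros DERIV_rad_param simp: field_simps power2_eq_square)

lemma DERIV_phi_ker:
  assumes "e \<in> param_dom" "v \<in> {0..2}"
  shows "((\<lambda>e. phi_ker e v) has_real_derivative phi_ker_e e v) (at e)"
proof -
  have pos: "radA e v > 0" "radC e v > 0" using assms rad_pos by auto
  have "((\<lambda>e. 1 / radA e v * (1 / sqrt (radC e v))) has_real_derivative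
      1 / radA e v * (- ((1 + (cosh v)\<^sup>2) / (2 * radC e v * sqrt (radC e v))))
      + - (cosh v)\<^sup>2 / (radA e v)\<^sup>2 * (1 / sqrt (radC e v))) (at e)"
    by (intro DERIV_mult' DERIV_inverse_radA DERIV_inverse_sqrt_radC pos)
  moreover have "1 / radA e v * (1 / sqrt (radC e v)) = phi_ker e v" for e
    by (simp add: phi_ker_def)
  moreover have "1 / radA e v * (- ((1 + (cosh v)\<^sup>2) / (2 * radC e v * sqrt (radC e v))))
      + - (cosh v)\<^sup>2 / (radA e v)\<^sup>2 * (1 / sqrt (radC e v)) = phi_ker_e e v"
    by (simp add: phi_ker_e_def mult_ac)
  ultimately show ?thesis by (simp only:)
qed

text \<open>In terms of \<open>w = 1 / radA\<close> and \<open>z = 1 / sqrt radC\<close> all derivatives are polynomials, because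
  \<open>w' = - C w\<^sup>2\<close> and \<open>z' = - (1 + C) z\<^sup>3 / 2\<close> with \<open>C = (cosh v)\<^sup>2\<close>.\<close>

lemma DERIV_phi_ker_e:
  assumes "e \<in> param_dom" "v \<in> {0..2}"
  shows "((\<lambda>e. phi_ker_e e v) has_real_derivative phi_ker_ee e v) (at e)"
proof -
  have pos: "radA e v > 0" "radC e v > 0" using assms rad_pos by auto
  define C where "C = (cosh v)\<^sup>2"
  let ?w = "\<lambda>e. 1 / radA e v" and ?z = "\<lambda>e. 1 / sqrt (radC e v)"
  let ?w' = "- C * (?w e)\<^sup>2" and ?z' = "- ((1 + C) / 2) * (?z e)^3"
  have z3: "(?z e)^3 = 1 / (radC e v * sqrt (radC e v))" if "radC e v > 0" for e
    using that by (simp add: power3_eq_cube field_simps)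
  have w: "(?w has_real_derivative ?w') (at e)"
    using DERIV_inverse_radA[OF pos(1)] by (simp add: C_def power_divide)
  have z: "(?z has_real_derivative ?z') (at e)"
    using DERIV_inverse_sqrt_radC[OF pos(2)] unfolding z3[OF pos(2)] by (simp add: C_def mult_ac)
  have A: "((\<lambda>e. - C * (?w e)\<^sup>2 * ?z e - (1 + C) / 2 * ?w e * (?z e)^3) has_real_derivative
      2 * C\<^sup>2 * (?w e)^3 * ?z e + C * (1 + C) * (?w e)\<^sup>2 * (?z e)^3 + 3 * (1 + C)\<^sup>2 / 4 * ?w e * (?z e)^5) (at e)"
    by (rule derivative_eq_intros w z refl | (simp add: field_simps eval_nat_numeral; fail))+
  have B: "\<forall>\<^sub>F x in nhds e. - C * (?w x)\<^sup>2 * ?z x - (1 + C) / 2 * ?w x * (?z x)^3 = phi_ker_e x v"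
  proof -
    have "\<forall>\<^sub>F x in nhds e. x \<in> param_dom" using assms by (intro eventually_nhds_in_open) (auto simp: param_dom_def)
    then show ?thesis
    proof eventually_elim
      case (elim x)
      then have "radC x v > 0" using rad_pos[of x v] assms by auto
      from z3[OF this] show ?case by (simp add: phi_ker_e_def C_def power_divide)
    qed
  qed
  have D: "2 * C\<^sup>2 * (?w e)^3 * ?z e + C * (1 + C) * (?w e)\<^sup>2 * (?z e)^3 + 3 * (1 + C)\<^sup>2 / 4 * ?w e * (?z e)^5 = phi_ker_ee e v"
  proof -
    have "(?z e)^5 = (?z e)^3 * (?z e)^2" by (simp flip: power_add)
    then have "(?z e)^5 = 1 / ((radC e v)\<^sup>2 * sqrt (radC e v))"
      unfolding z3[OF pos(2)] using pos by (simp add: power_divide power2_eq_square)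
    then show ?thesis unfolding z3[OF pos(2)] by (simp add: phi_ker_ee_def C_def power_divide)
  qed
  show ?thesis using iffD1[OF DERIV_cong_ev[OF refl B D] A] .
qed

lemma continuous_on_phi_ker:
  "continuous_on (param_dom \<times> {0..2}) (\<lambda>(e, v). phi_ker e v)"
  "continuous_on (param_dom \<times> {0..2}) (\<lambda>(e, v). phi_ker_e e v)"
  "continuous_on (param_dom \<times> {0..2}) (\<lambda>(e, v). phi_ker_ee e v)"
proof -
  have [simp]: "radA (fst p) (snd p) \<noteq> 0" "radC (fst p) (snd p) \<noteq> 0" "radC (fst p) (snd p) > 0"
    if "p \<in> param_dom \<times> {0..2}" for p
    using rad_pos[of "fst p" "snd p"] that by auto
  show "continuous_on (param_dom \<times> {0..2}) (\<lambda>(e, v). phi_ker e v)"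
    unfolding phi_ker_def split_beta by (intro continuous_intros) auto
  show "continuous_on (param_dom \<times> {0..2}) (\<lambda>(e, v). phi_ker_e e v)"
    unfolding phi_ker_e_def split_beta by (intro continuous_intros) auto
  show "continuous_on (param_dom \<times> {0..2}) (\<lambda>(e, v). phi_ker_ee e v)"
    unfolding phi_ker_ee_def split_beta by (intro continuous_intros) auto
qed

lemma C1_integral_phi_ker:
  "C1_on_rect param_dom height_dom (\<lambda>e u. integral {0..u} (phi_ker e)) (\<lambda>e u. integral {0..u} (phi_ker_e e)) phi_ker"
  unfolding height_dom_def by (intro C1_on_rect_integral DERIV_phi_ker continuous_on_phi_ker) (auto simp: param_dom_def)

lemma C1_integral_phi_ker_e:
  "C1_on_rect param_dom height_dom (\<lambda>e u. integral {0..u} (phi_ker_e e)) (\<lambda>e u. integral {0..u} (phi_ker_ee e)) phi_ker_e"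
  unfolding height_dom_def by (intro C1_on_rect_integral DERIV_phi_ker_e continuous_on_phi_ker) (auto simp: param_dom_def)

section \<open>The rescaled right side of the boundary equation\<close>

text \<open>The right side \<open>B K / (a sinh (2 s))\<close> of the boundary equation, divided by \<open>K\<close> and written in \<open>u\<close>.\<close>

definition rhs_over_K :: "real \<Rightarrow> real \<Rightarrow> real" where
  "rhs_over_K e u = cosh u / (sinh u * sqrt (radC e u))"

definition rhs_over_K_e :: "real \<Rightarrow> real \<Rightarrow> real" where
  "rhs_over_K_e e u = - rhs_over_K e u * (1 + (cosh u)\<^sup>2) / (2 * radC e u)"

definition rhs_over_K_u :: "real \<Rightarrow> real \<Rightarrow> real" where
  "rhs_over_K_u e u = - (1 / (sinh u)\<^sup>2 + e * (cosh u)\<^sup>2 / radC e u) / sqrt (radC e u)"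

text \<open>This is \<open>artanh (K q) / K\<close> with \<open>q = rhs_over_K e u\<close>, in a form that makes sense for \<open>e \<le> 0\<close>.\<close>

definition artanh_over_K :: "real \<Rightarrow> real \<Rightarrow> real" where
  "artanh_over_K e u = rhs_over_K e u * artanhc (e * (1 + e) * (rhs_over_K e u)\<^sup>2)"

definition artanh_over_K_e :: "real \<Rightarrow> real \<Rightarrow> real" where
  "artanh_over_K_e e u = rhs_over_K_e e u * artanhc (e * (1 + e) * (rhs_over_K e u)\<^sup>2)
     + rhs_over_K e u * (artanhc' (e * (1 + e) * (rhs_over_K e u)\<^sup>2) *
        ((1 + 2 * e) * (rhs_over_K e u)\<^sup>2 + e * (1 + e) * (2 * rhs_over_K e u * rhs_over_K_e e u)))"

definition artanh_over_K_u :: "real \<Rightarrow> real \<Rightarrow> real" where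
  "artanh_over_K_u e u = rhs_over_K_u e u * artanhc (e * (1 + e) * (rhs_over_K e u)\<^sup>2)
     + rhs_over_K e u * (artanhc' (e * (1 + e) * (rhs_over_K e u)\<^sup>2) * (e * (1 + e) * (2 * rhs_over_K e u * rhs_over_K_u e u)))"

lemma rhs_over_K_0 [simp]: "rhs_over_K 0 u = cosh u / sinh u"
  by (simp add: rhs_over_K_def)

lemma rhs_over_K_arg_less_1:
  assumes "e \<in> param_dom" "u \<in> height_dom"
  shows "\<bar>e * (1 + e) * (rhs_over_K e u)\<^sup>2\<bar> < 1"
proof -
  have E: "radC e u \<ge> 1/2" using rad_ge_half[of e u] assms by (auto simp: height_dom_def)
  have s: "(sinh u)\<^sup>2 > 1" using sinh_sq_gt_1[of u] assms by (auto simp: height_dom_def)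
  have "(rhs_over_K e u)\<^sup>2 = ((1 + (sinh u)\<^sup>2) / (sinh u)\<^sup>2) * (1 / radC e u)"
    using E by (simp add: rhs_over_K_def power_divide power_mult_distrib cosh_square_eq add.commute)
  also have "\<dots> \<le> 2 * 2"
    using E s by (intro mult_mono) (auto simp: divide_le_eq)
  finally have q: "(rhs_over_K e u)\<^sup>2 \<le> 4" by simp
  have "\<bar>e * (1 + e) * (rhs_over_K e u)\<^sup>2\<bar> \<le> (1/100 * 2) * 4"
    unfolding abs_mult using assms q by (intro mult_mono) (auto simp: param_dom_def)
  then show ?thesis by simp
qed

lemma DERIV_rhs_over_K_e:
  assumes "e \<in> param_dom" "u \<in> height_dom"
  shows "((\<lambda>e. rhs_over_K e u) has_real_derivative rhs_over_K_e e u) (at e)"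
proof -
  have "((\<lambda>e. cosh u / sinh u * (1 / sqrt (radC e u))) has_real_derivative
      cosh u / sinh u * (- ((1 + (cosh u)\<^sup>2) / (2 * radC e u * sqrt (radC e u))))) (at e)"
    by (intro DERIV_cmult DERIV_inverse_sqrt_radC rad_pos_dom assms)
  then show ?thesis by (simp add: rhs_over_K_def[abs_def] rhs_over_K_e_def mult_ac)
qed

lemma DERIV_radC_u: "((\<lambda>u. radC e u) has_real_derivative e * (2 * cosh u * sinh u)) (at u)"
  unfolding radC_def by (auto intro!: derivative_eq_intros)

lemma DERIV_rhs_over_K_u:
  assumes "e \<in> param_dom" "u \<in> height_dom"
  shows "((\<lambda>u. rhs_over_K e u) has_real_derivative rhs_over_K_u e u) (at u)"
proof -
  have E: "radC e u > 0" and s: "sinh u > 0" using rad_pos_dom sinh_pos_height_dom assms by auto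
  define R where "R = sqrt (radC e u)"
  have R: "R > 0" "radC e u = R\<^sup>2" using E by (auto simp: R_def)
  have A: "((\<lambda>u. cosh u / (sinh u * sqrt (radC e u))) has_real_derivative
      (sinh u * (sinh u * R) - cosh u * (cosh u * R + sinh u * (e * (2 * cosh u * sinh u) / (2 * R))))
        / (sinh u * R)\<^sup>2) (at u)"
    using E s by (auto intro!: derivative_eq_intros DERIV_radC_u simp: R_def power2_eq_square field_simps)
  have "(sinh u * (sinh u * R) - cosh u * (cosh u * R + sinh u * (e * (2 * cosh u * sinh u) / (2 * R))))
        / (sinh u * R)\<^sup>2 = (((sinh u)\<^sup>2 - (cosh u)\<^sup>2) / (sinh u)\<^sup>2 - e * (cosh u)\<^sup>2 / R\<^sup>2) / R"
    using R s by (simp add: field_simps power2_eq_square)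
  also have "(sinh u)\<^sup>2 - (cosh u)\<^sup>2 = -1" by (simp add: cosh_square_eq)
  also have "(- 1 / (sinh u)\<^sup>2 - e * (cosh u)\<^sup>2 / R\<^sup>2) / R = rhs_over_K_u e u"
    unfolding rhs_over_K_u_def R_def[symmetric] R(2) using R(1) by (simp add: diff_divide_distrib add_divide_distrib)
  finally show ?thesis using A unfolding rhs_over_K_def by (simp only:)
qed

lemma DERIV_artanh_over_K_e:
  assumes "e \<in> param_dom" "u \<in> height_dom"
  shows "((\<lambda>e. artanh_over_K e u) has_real_derivative artanh_over_K_e e u) (at e)"
proof -
  have "((\<lambda>e. e * (1 + e) * (rhs_over_K e u)\<^sup>2) has_real_derivative
      (1 + 2 * e) * (rhs_over_K e u)\<^sup>2 + e * (1 + e) * (2 * rhs_over_K e u * rhs_over_K_e e u)) (at e)"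
    by (auto intro!: derivative_eq_intros DERIV_rhs_over_K_e assms simp: algebra_simps)
  from DERIV_chain2[OF DERIV_artanhc[OF rhs_over_K_arg_less_1[OF assms]] this]
  have "((\<lambda>e. artanhc (e * (1 + e) * (rhs_over_K e u)\<^sup>2)) has_real_derivative
      artanhc' (e * (1 + e) * (rhs_over_K e u)\<^sup>2) *
        ((1 + 2 * e) * (rhs_over_K e u)\<^sup>2 + e * (1 + e) * (2 * rhs_over_K e u * rhs_over_K_e e u))) (at e)" .
  from DERIV_mult'[OF DERIV_rhs_over_K_e[OF assms] this]
  show ?thesis unfolding artanh_over_K_def artanh_over_K_e_def by (simp add: add.commute)
qed

lemma DERIV_artanh_over_K_u:
  assumes "e \<in> param_dom" "u \<in> height_dom"
  shows "((\<lambda>u. artanh_over_K e u) has_real_derivative artanh_over_K_u e u) (at u)"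
proof -
  have "((\<lambda>u. e * (1 + e) * (rhs_over_K e u)\<^sup>2) has_real_derivative
      e * (1 + e) * (2 * rhs_over_K e u * rhs_over_K_u e u)) (at u)"
    by (auto intro!: derivative_eq_intros DERIV_rhs_over_K_u assms simp: algebra_simps)
  from DERIV_chain2[OF DERIV_artanhc[OF rhs_over_K_arg_less_1[OF assms]] this]
  have "((\<lambda>u. artanhc (e * (1 + e) * (rhs_over_K e u)\<^sup>2)) has_real_derivative
      artanhc' (e * (1 + e) * (rhs_over_K e u)\<^sup>2) * (e * (1 + e) * (2 * rhs_over_K e u * rhs_over_K_u e u))) (at u)" .
  from DERIV_mult'[OF DERIV_rhs_over_K_u[OF assms] this]
  show ?thesis unfolding artanh_over_K_def artanh_over_K_u_def by (simp add: add.commute)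
qed

lemma C1_artanh_over_K: "C1_on_rect param_dom height_dom artanh_over_K artanh_over_K_e artanh_over_K_u"
proof -
  let ?D = "param_dom \<times> height_dom"
  have nz: "radC (fst p) (snd p) \<noteq> 0" "sinh (snd p) \<noteq> 0" "sqrt (radC (fst p) (snd p)) \<noteq> 0"
    if "p \<in> ?D" for p
    using rad_pos_dom[of "fst p" "snd p"] sinh_pos_height_dom[of "snd p"] that by auto
  have s: "continuous_on ?D (\<lambda>p. rhs_over_K (fst p) (snd p))"
    unfolding rhs_over_K_def by (intro continuous_intros) (use nz in auto)
  have se: "continuous_on ?D (\<lambda>p. rhs_over_K_e (fst p) (snd p))"
    unfolding rhs_over_K_e_def by (intro continuous_intros s) (use nz in auto)
  have su: "continuous_on ?D (\<lambda>p. rhs_over_K_u (fst p) (snd p))"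
    unfolding rhs_over_K_u_def by (intro continuous_intros s) (use nz in auto)
  let ?x = "\<lambda>p. fst p * (1 + fst p) * (rhs_over_K (fst p) (snd p))\<^sup>2"
  have x: "continuous_on ?D ?x" by (intro continuous_intros s)
  have im: "?x ` ?D \<subseteq> {-1<..<1}" using rhs_over_K_arg_less_1 by (force simp: abs_less_iff)
  have h: "continuous_on ?D (\<lambda>p. artanhc (?x p))" "continuous_on ?D (\<lambda>p. artanhc' (?x p))"
    by (intro continuous_on_compose2[OF _ x im] continuous_on_artanhc)+
  have "continuous_on ?D (\<lambda>p. artanh_over_K_e (fst p) (snd p))"
    unfolding artanh_over_K_e_def by (intro continuous_intros s se h)
  moreover have "continuous_on ?D (\<lambda>p. artanh_over_K_u (fst p) (snd p))"
    unfolding artanh_over_K_u_def by (intro continuous_intros s su h)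
  ultimately show ?thesis
    using DERIV_artanh_over_K_e DERIV_artanh_over_K_u
    by (auto simp: C1_on_rect_def split_beta param_dom_def height_dom_def)
qed

section \<open>The root curve\<close>

lemma strict_mono_sigma_eq:
  fixes x y :: real
  assumes "0 \<le> x" "x < y"
  shows "x * sinh x - cosh x < y * sinh y - cosh y"
proof (rule DERIV_pos_imp_increasing_open[OF assms(2)])
  fix z assume "x < z" "z < y"
  then show "\<exists>d. ((\<lambda>x. x * sinh x - cosh x) has_real_derivative d) (at z) \<and> 0 < d"
    using assms by (intro exI[of _ "z * cosh z"]) (auto intro!: derivative_eq_intros)
qed (auto intro!: continuous_intros)

text \<open>For positive \<open>x\<close>, \<open>x = coth x\<close> says that \<open>x sinh x - cosh x\<close>, an increasing function, vanishes.\<close>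

lemma sigma_star:
  shows "1 < sigma_star" "sigma_star < 2" "cosh sigma_star = sigma_star * sinh sigma_star"
proof -
  let ?f = "\<lambda>x::real. x * sinh x - cosh x"
  have f1: "?f 1 < 0" by (simp add: sinh_field_def cosh_field_def)
  have "3 \<le> exp (2::real)" using exp_ge_add_one_self[of 2] by simp
  moreover have "exp (-2::real) < 1" by simp
  ultimately have "0 < (exp 2 - 3 * exp (-2::real)) / 2" by argo
  also have "\<dots> = ?f 2" by (simp add: sinh_field_def cosh_field_def field_simps)
  finally have f2: "0 < ?f 2" .
  have "\<exists>x\<ge>1. x \<le> 2 \<and> ?f x = 0"
    using f1 f2 by (intro IVT) (auto intro!: continuous_intros)
  then obtain s where s: "1 \<le> s" "s \<le> 2" "?f s = 0" by blast
  then have s': "1 < s" "s < 2" using f1 f2 by (auto simp: less_le)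
  have "sigma_star = s"
    unfolding sigma_star_def
  proof (rule the_equality)
    show "0 < s \<and> s = coth s" using s s' by (simp add: coth_def field_simps)
    fix x assume x: "0 < x \<and> x = coth x"
    then have "x = cosh x / sinh x" "sinh x \<noteq> 0" by (auto simp: coth_def)
    then have "?f x = 0" by (simp add: nonzero_eq_divide_eq)
    then show "x = s"
      using strict_mono_sigma_eq[of x s] strict_mono_sigma_eq[of s x] x s s'
      by (cases x s rule: linorder_cases) auto
  qed
  then show "1 < sigma_star" "sigma_star < 2" "cosh sigma_star = sigma_star * sinh sigma_star"
    using s s' by auto
qed

text \<open>The boundary equation \<open>tanh \<phi> = K q\<close> after applying \<open>artanh\<close> and dividing by \<open>K\<close>. At \<open>e = 0\<close> it
  degenerates to \<open>u = coth u\<close>.\<close>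

definition defect :: "real \<Rightarrow> real \<Rightarrow> real" where
  "defect e u = integral {0..u} (phi_ker e) - artanh_over_K e u"

definition defect_e :: "real \<Rightarrow> real \<Rightarrow> real" where
  "defect_e e u = integral {0..u} (phi_ker_e e) - artanh_over_K_e e u"

definition defect_u :: "real \<Rightarrow> real \<Rightarrow> real" where
  "defect_u e u = phi_ker e u - artanh_over_K_u e u"

lemma C1_defect: "C1_on_rect param_dom height_dom defect defect_e defect_u"
  using C1_on_rect_diff[OF C1_integral_phi_ker C1_artanh_over_K]
  unfolding defect_def[abs_def] defect_e_def[abs_def] defect_u_def[abs_def] .

lemma defect_0:
  assumes "0 \<le> u" shows "defect 0 u = u - cosh u / sinh u"
proof -
  have "phi_ker 0 = (\<lambda>v. 1)" by (simp add: phi_ker_def fun_eq_iff)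
  then show ?thesis using assms by (simp add: defect_def artanh_over_K_def)
qed

lemma defect_u_0: "defect_u 0 u = 1 + 1 / (sinh u)\<^sup>2"
  by (simp add: defect_u_def artanh_over_K_u_def phi_ker_def rhs_over_K_u_def)

text \<open>At \<open>e = 0\<close> the integrand is \<open>- (3 cosh\<^sup>2 v + 1) / 2\<close>.\<close>

lemma integral_phi_ker_e_0:
  assumes "0 \<le> u"
  shows "integral {0..u} (phi_ker_e 0) = - (5 * u + 3 * sinh u * cosh u) / 4"
proof -
  have "((\<lambda>v. - (cosh v)\<^sup>2 - (1 + (cosh v)\<^sup>2) / 2) has_integral
      (- (5 * u + 3 * sinh u * cosh u) / 4 - (- (5 * 0 + 3 * sinh 0 * cosh 0) / 4))) {0..u}"
  proof (rule fundamental_theorem_of_calculus[OF assms])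
    fix x assume "x \<in> {0..u}"
    have "((\<lambda>u. - (5 * u + 3 * sinh u * cosh u) / 4) has_real_derivative
        - (5 + 3 * (cosh x * cosh x + sinh x * sinh x)) / 4) (at x)"
      by (rule derivative_eq_intros refl)+ (simp_all add: field_simps)
    moreover have "sinh x * sinh x = (cosh x)\<^sup>2 - 1"
      by (simp add: cosh_square_eq flip: power2_eq_square)
    then have "- (5 + 3 * (cosh x * cosh x + sinh x * sinh x)) / 4 = - (cosh x)\<^sup>2 - (1 + (cosh x)\<^sup>2) / 2"
      by (simp add: power2_eq_square field_simps)
    ultimately show "((\<lambda>u. - (5 * u + 3 * sinh u * cosh u) / 4) has_vector_derivative
        (- (cosh x)\<^sup>2 - (1 + (cosh x)\<^sup>2) / 2)) (at x within {0..u})"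
      by (simp only: has_real_derivative_iff_has_vector_derivative has_vector_derivative_at_within)
  qed
  moreover have "phi_ker_e 0 = (\<lambda>v. - (cosh v)\<^sup>2 - (1 + (cosh v)\<^sup>2) / 2)"
    by (simp add: phi_ker_e_def fun_eq_iff)
  ultimately show ?thesis by (simp add: integral_unique)
qed

lemma defect_e_0:
  assumes "0 < u"
  defines "q \<equiv> cosh u / sinh u"
  shows "defect_e 0 u = - (5 * u + 3 * sinh u * cosh u) / 4 + q * (1 + (cosh u)\<^sup>2) / 2 - q ^ 3 / 3"
  unfolding defect_e_def integral_phi_ker_e_0[OF less_imp_le[OF assms(1)]]
  by (simp add: artanh_over_K_e_def rhs_over_K_e_def q_def power3_eq_cube power2_eq_square)

text \<open>The relation \<open>\<sigma>\<^sub>* = coth \<sigma>\<^sub>*\<close> eliminates \<open>\<sigma>\<^sub>*\<close> in favour of its hyperbolic functions.\<close>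

lemma root_curve_deriv_at_0:
  "- defect_e 0 sigma_star / defect_u 0 sigma_star
     = sinh sigma_star * cosh sigma_star / 4 + cosh sigma_star / (3 * sinh sigma_star)"
proof -
  define s c where "s = sinh sigma_star" and "c = cosh sigma_star"
  have s: "s > 0" and c: "c > 0" using sigma_star by (auto simp: s_def c_def)
  have q: "sigma_star = c / s" using sigma_star s by (simp add: s_def c_def field_simps)
  have cs: "c\<^sup>2 = 1 + s\<^sup>2" by (simp add: s_def c_def cosh_square_eq)
  have Fu: "defect_u 0 sigma_star = c\<^sup>2 / s\<^sup>2"
    using s by (simp add: defect_u_0 cs flip: s_def) (simp add: field_simps)
  have "defect_e 0 sigma_star = - (5 * sigma_star + 3 * s * c) / 4 + c / s * (1 + c\<^sup>2) / 2 - (c / s) ^ 3 / 3"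
    using defect_e_0[of sigma_star] sigma_star(1) unfolding s_def c_def by linarith
  also have "\<dots> = - (c / s) * ((5 + 3 * s\<^sup>2) / 4 - (1 + c\<^sup>2) / 2) - (c / s) * (c\<^sup>2 / s\<^sup>2) / 3"
    unfolding q using s by (simp add: field_simps power2_eq_square power3_eq_cube)
  also have "\<dots> = - (c / s) * (c\<^sup>2 / 4 + c\<^sup>2 / (3 * s\<^sup>2))"
    using s by (simp add: cs field_simps)
  finally have "- defect_e 0 sigma_star / defect_u 0 sigma_star = (c / s) * (c\<^sup>2 / 4 + c\<^sup>2 / (3 * s\<^sup>2)) / (c\<^sup>2 / s\<^sup>2)"
    unfolding Fu by simp
  also have "\<dots> = s * c / 4 + c / (3 * s)"
    using s c by (simp add: field_simps power2_eq_square)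
  finally show ?thesis by (simp add: s_def c_def)
qed

lemma root_curve:
  obtains \<delta> U where "\<delta> > 0" "ball 0 \<delta> \<subseteq> param_dom" "U 0 = sigma_star"
    "\<And>e. e \<in> ball 0 \<delta> \<Longrightarrow> U e \<in> height_dom \<and> defect e (U e) = 0 \<and> defect_u e (U e) > 0 \<and>
       (U has_real_derivative - defect_e e (U e) / defect_u e (U e)) (at e)"
proof (rule implicit_function_rect[OF C1_defect, of 0 sigma_star])
  show "0 \<in> param_dom" by (simp add: param_dom_def)
  show "sigma_star \<in> height_dom" using sigma_star by (simp add: height_dom_def)
  show "defect 0 sigma_star = 0" using sigma_star by (simp add: defect_0)
  show "0 < defect_u 0 sigma_star" by (simp add: defect_u_0 add_pos_nonneg)
qed (use that in blast)

text \<open>Second order differentiability of the root curve at the limit point turns the convergence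
  \<open>H' \<rightarrow> C\<^sub>0\<close> into the rate \<open>H' = C\<^sub>0 + O(e)\<close>. The proof propagates the existence of
  derivatives through the formula for \<open>U'\<close>.\<close>

lemma root_curve_second_derivative:
  assumes U0: "U 0 \<in> height_dom" "defect_u 0 (U 0) > 0" and U: "(U has_real_derivative D) (at 0)"
  shows "\<exists>D. ((\<lambda>e. - defect_e e (U e) / defect_u e (U e)) has_real_derivative D) (at 0)"
proof -
  have 0: "0 \<in> param_dom" by (simp add: param_dom_def)
  have u: "sinh (U 0) > 0" using U0 sinh_pos_height_dom by auto
  have int: "\<exists>D. ((\<lambda>e. integral {0..U e} (phi_ker_e e)) has_real_derivative D) (at 0)"
    using C1_on_rect_chain[OF C1_integral_phi_ker_e 0 U0(1) U] by blast
  have U1: "\<exists>D. (U has_real_derivative D) (at 0)" using U by blast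
  have add: "\<exists>D. (a has_real_derivative D) (at 0) \<Longrightarrow> \<exists>D. (b has_real_derivative D) (at 0)
      \<Longrightarrow> \<exists>D. ((\<lambda>e. a e + b e) has_real_derivative D) (at 0)"
   and diff: "\<exists>D. (a has_real_derivative D) (at 0) \<Longrightarrow> \<exists>D. (b has_real_derivative D) (at 0)
      \<Longrightarrow> \<exists>D. ((\<lambda>e. a e - b e) has_real_derivative D) (at 0)"
   and mult: "\<exists>D. (a has_real_derivative D) (at 0) \<Longrightarrow> \<exists>D. (b has_real_derivative D) (at 0)
      \<Longrightarrow> \<exists>D. ((\<lambda>e. a e * b e) has_real_derivative D) (at 0)"
   and divide: "\<exists>D. (a has_real_derivative D) (at 0) \<Longrightarrow> \<exists>D. (b has_real_derivative D) (at 0)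
      \<Longrightarrow> b 0 \<noteq> 0 \<Longrightarrow> \<exists>D. ((\<lambda>e. a e / b e) has_real_derivative D) (at 0)"
   and neg: "\<exists>D. (a has_real_derivative D) (at 0) \<Longrightarrow> \<exists>D. ((\<lambda>e. - a e) has_real_derivative D) (at 0)"
   and pow: "\<exists>D. (a has_real_derivative D) (at 0) \<Longrightarrow> \<exists>D. ((\<lambda>e. a e ^ n) has_real_derivative D) (at 0)"
   and const: "\<exists>D. ((\<lambda>e. k) has_real_derivative D) (at 0)"
   and ident: "\<exists>D. ((\<lambda>e. e) has_real_derivative D) (at 0)"
   for a b :: "real \<Rightarrow> real" and k :: real and n
    by (blast intro: DERIV_add DERIV_diff DERIV_mult DERIV_divide DERIV_minus DERIV_power DERIV_const DERIV_ident)+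
  have chain: "\<exists>D. ((\<lambda>e. h (a e)) has_real_derivative D) (at 0)"
    if "\<exists>D. (a has_real_derivative D) (at 0)" "\<exists>D. (h has_real_derivative D) (at (a 0))" for h a :: "real \<Rightarrow> real"
    using that DERIV_chain2[of h _ a 0] by blast
  note basic = add diff mult divide neg pow const ident U1
  have cosh: "\<exists>D. ((\<lambda>e. cosh (U e)) has_real_derivative D) (at 0)"
    and sinh: "\<exists>D. ((\<lambda>e. sinh (U e)) has_real_derivative D) (at 0)"
    using U by (blast intro: derivative_intros)+
  have E: "\<exists>D. ((\<lambda>e. radC e (U e)) has_real_derivative D) (at 0)"
   and P: "\<exists>D. ((\<lambda>e. radA e (U e)) has_real_derivative D) (at 0)"
    unfolding radC_def radA_def by (intro basic cosh)+
  have R: "\<exists>D. ((\<lambda>e. sqrt (radC e (U e))) has_real_derivative D) (at 0)"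
    by (rule chain[OF E]) (auto intro!: exI DERIV_real_sqrt)
  have k: "\<exists>D. ((\<lambda>e. phi_ker e (U e)) has_real_derivative D) (at 0)"
    unfolding phi_ker_def by (intro basic P R) simp
  have q: "\<exists>D. ((\<lambda>e. rhs_over_K e (U e)) has_real_derivative D) (at 0)"
    unfolding rhs_over_K_def by (intro basic cosh sinh R) (use u in simp)
  have qe: "\<exists>D. ((\<lambda>e. rhs_over_K_e e (U e)) has_real_derivative D) (at 0)"
    unfolding rhs_over_K_e_def by (intro basic cosh q E) simp
  have qu: "\<exists>D. ((\<lambda>e. rhs_over_K_u e (U e)) has_real_derivative D) (at 0)"
    unfolding rhs_over_K_u_def by (intro basic cosh sinh R E) (use u in simp_all)
  let ?x = "\<lambda>e. e * (1 + e) * (rhs_over_K e (U e))\<^sup>2"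
  have x: "\<exists>D. (?x has_real_derivative D) (at 0)" by (intro basic q)
  have h: "\<exists>D. ((\<lambda>e. artanhc (?x e)) has_real_derivative D) (at 0)"
    and h': "\<exists>D. ((\<lambda>e. artanhc' (?x e)) has_real_derivative D) (at 0)"
    by (rule chain[OF x]; use DERIV_artanhc[of 0] DERIV_artanhc'[of 0] in auto)+
  have Fe: "\<exists>D. ((\<lambda>e. defect_e e (U e)) has_real_derivative D) (at 0)"
    unfolding defect_e_def artanh_over_K_e_def by (intro basic int q qe h h')
  have Fu: "\<exists>D. ((\<lambda>e. defect_u e (U e)) has_real_derivative D) (at 0)"
    unfolding defect_u_def artanh_over_K_u_def by (intro basic k q qu h h')
  show ?thesis by (intro divide neg Fe Fu) (use U0 in simp)
qed

section \<open>The derivative of H at the limit\<close>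

text \<open>The value of \<open>H\<close> when \<open>u\<close> is the rescaled root. The function after it is the derivative in \<open>e\<close>
  along a curve with height \<open>u\<close> and velocity \<open>u'\<close>.\<close>

definition Hprofile :: "real \<Rightarrow> real \<Rightarrow> real" where
  "Hprofile e u = (cosh u)\<^sup>2 / sqrt ((1 + e) * ((sinh u)\<^sup>2 - e))"

definition Hprofile_deriv :: "real \<Rightarrow> real \<Rightarrow> real \<Rightarrow> real" where
  "Hprofile_deriv e u u' = 2 * sinh u * cosh u * u' / sqrt ((1 + e) * ((sinh u)\<^sup>2 - e))
     - (cosh u)\<^sup>2 * ((sinh u)\<^sup>2 - e + (1 + e) * (2 * sinh u * cosh u * u' - 1))
       / (2 * ((1 + e) * ((sinh u)\<^sup>2 - e)) * sqrt ((1 + e) * ((sinh u)\<^sup>2 - e)))"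

lemma Hprofile_arg_pos:
  assumes "e \<in> param_dom" "u \<in> height_dom"
  shows "(1 + e) * ((sinh u)\<^sup>2 - e) > 0"
proof (intro mult_pos_pos)
  have "(sinh u)\<^sup>2 > 1" using sinh_sq_gt_1[of u] assms by (simp add: height_dom_def)
  moreover have "\<bar>e\<bar> < 1" using assms by (auto simp: param_dom_def)
  ultimately show "0 < 1 + e" "0 < (sinh u)\<^sup>2 - e" by linarith+
qed

lemma DERIV_Hprofile:
  assumes e: "e \<in> param_dom" "U e \<in> height_dom" and U: "(U has_real_derivative u') (at e)"
  shows "((\<lambda>e. Hprofile e (U e)) has_real_derivative Hprofile_deriv e (U e) u') (at e)"
proof -
  have pos: "(1 + e) * ((sinh (U e))\<^sup>2 - e) > 0" using Hprofile_arg_pos e by auto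
  define N where "N = (\<lambda>e. (1 + e) * ((sinh (U e))\<^sup>2 - e))"
  define n where "n = (sinh (U e))\<^sup>2 - e + (1 + e) * (2 * sinh (U e) * cosh (U e) * u' - 1)"
  have N: "(N has_real_derivative n) (at e)"
    unfolding N_def n_def by (auto intro!: derivative_eq_intros U simp: algebra_simps)
  have N0: "N e > 0" using pos by (simp add: N_def)
  have sq: "((\<lambda>e. sqrt (N e)) has_real_derivative n / (2 * sqrt (N e))) (at e)"
    using N N0 by (auto intro!: derivative_eq_intros simp: field_simps)
  have c: "((\<lambda>e. (cosh (U e))\<^sup>2) has_real_derivative 2 * sinh (U e) * cosh (U e) * u') (at e)"
    by (auto intro!: derivative_eq_intros U)
  have "((\<lambda>e. (cosh (U e))\<^sup>2 / sqrt (N e)) has_real_derivative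
     (2 * sinh (U e) * cosh (U e) * u' * sqrt (N e) - (cosh (U e))\<^sup>2 * (n / (2 * sqrt (N e))))
      / (sqrt (N e) * sqrt (N e))) (at e)"
    by (intro DERIV_divide c sq) (use N0 in auto)
  moreover have "(2 * sinh (U e) * cosh (U e) * u' * sqrt (N e) - (cosh (U e))\<^sup>2 * (n / (2 * sqrt (N e))))
      / (sqrt (N e) * sqrt (N e))
     = 2 * sinh (U e) * cosh (U e) * u' / sqrt (N e) - (cosh (U e))\<^sup>2 * n / (2 * N e * sqrt (N e))"
  proof -
    define R where "R = sqrt (N e)"
    have "R > 0" "N e = R * R" using N0 by (auto simp: R_def)
    then show ?thesis unfolding R_def[symmetric] by (simp add: field_simps)
  qed
  ultimately show ?thesis unfolding Hprofile_def Hprofile_deriv_def N_def n_def by simp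
qed

lemma DERIV_Hprofile_deriv:
  assumes U0: "U 0 \<in> height_dom" and U: "(U has_real_derivative D) (at 0)" and V: "(V has_real_derivative D') (at 0)"
  shows "\<exists>D. ((\<lambda>e. Hprofile_deriv e (U e) (V e)) has_real_derivative D) (at 0)"
proof -
  have s: "sinh (U 0) > 0" using U0 sinh_pos_height_dom by auto
  define N where "N = (\<lambda>e. (1 + e) * ((sinh (U e))\<^sup>2 - e))"
  have N0: "N 0 > 0" using s by (simp add: N_def)
  have "\<exists>n. (N has_real_derivative n) (at 0)"
    unfolding N_def by (rule exI) (rule derivative_eq_intros U refl)+
  then obtain n where N: "(N has_real_derivative n) (at 0)" by blast
  have R: "((\<lambda>e. sqrt (N e)) has_real_derivative inverse (sqrt (N 0)) / 2 * n) (at 0)"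
    using DERIV_chain2[OF DERIV_real_sqrt[OF N0] N] .
  have "\<exists>D. ((\<lambda>e. 2 * sinh (U e) * cosh (U e) * V e / sqrt (N e)
     - (cosh (U e))\<^sup>2 * ((sinh (U e))\<^sup>2 - e + (1 + e) * (2 * sinh (U e) * cosh (U e) * V e - 1))
       / (2 * N e * sqrt (N e))) has_real_derivative D) (at 0)"
    by (rule exI, (rule derivative_eq_intros U V N R refl | (use N0 in simp; fail))+)
  then show ?thesis unfolding Hprofile_deriv_def N_def .
qed

lemma Hprofile_0: "Hprofile 0 sigma_star = sigma_star * cosh sigma_star"
  using sigma_star by (simp add: Hprofile_def power2_eq_square)

text \<open>With \<open>s\<close>, \<open>c\<close> the hyperbolic functions of \<open>\<sigma>\<^sub>*\<close> and \<open>d\<close> the velocity of the root curve, the logarithmic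
  derivative is \<open>(s\<^sup>2 - 1) (d / (s c) - 1 / (2 s\<^sup>2))\<close>, and inserting \<open>d\<close> produces the factor
  \<open>3 s\<^sup>2 - 2\<close>.\<close>

lemma Hprofile_deriv_0: "Hprofile_deriv 0 sigma_star (- defect_e 0 sigma_star / defect_u 0 sigma_star) = C0"
proof -
  define s c where "s = sinh sigma_star" and "c = cosh sigma_star"
  have s: "s > 0" and c: "c > 0" using sigma_star by (auto simp: s_def c_def)
  have q: "sigma_star = c / s" using sigma_star s by (simp add: s_def c_def field_simps)
  have cs: "c\<^sup>2 = 1 + s\<^sup>2" by (simp add: s_def c_def cosh_square_eq)
  define d where "d = s * c / 4 + c / (3 * s)"
  have "Hprofile_deriv 0 sigma_star (- defect_e 0 sigma_star / defect_u 0 sigma_star)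
      = 2 * s * c * d / s - c\<^sup>2 * (s\<^sup>2 + (2 * s * c * d - 1)) / (2 * s\<^sup>2 * s)"
    unfolding Hprofile_deriv_def root_curve_deriv_at_0 s_def[symmetric] c_def[symmetric] d_def[symmetric]
    using s by simp
  also have "\<dots> = (c\<^sup>2 / s) * ((2 * s\<^sup>2 - c\<^sup>2) * (d / c) / s - (s\<^sup>2 - 1) / (2 * s\<^sup>2))"
    using s c by (simp add: field_simps power2_eq_square power3_eq_cube)
  also have "d / c = s / 4 + 1 / (3 * s)"
    using s c by (simp add: d_def field_simps)
  also have "2 * s\<^sup>2 - c\<^sup>2 = s\<^sup>2 - 1" by (simp add: cs)
  also have "(c\<^sup>2 / s) * ((s\<^sup>2 - 1) * (s / 4 + 1 / (3 * s)) / s - (s\<^sup>2 - 1) / (2 * s\<^sup>2))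
      = (c / s) * c * (s\<^sup>2 - 1) * (3 * s\<^sup>2 - 2) / (12 * s\<^sup>2)"
    using s c by (simp add: field_simps power2_eq_square)
  finally show ?thesis unfolding C0_def s_def[symmetric] c_def[symmetric] by (simp add: q)
qed

text \<open>Both differences in the numerator are positive because \<open>sinh \<sigma>\<^sub>* > \<sigma>\<^sub>* > 1\<close>.\<close>

lemma C0_pos: "C0 > 0"
proof -
  have "(sinh sigma_star)\<^sup>2 > 1" "sinh sigma_star > 0"
    using sinh_sq_gt_1[of sigma_star] sigma_star by auto
  then show ?thesis using sigma_star unfolding C0_def
    by (intro divide_pos_pos mult_pos_pos) auto
qed

section \<open>Back to the catenoid\<close>

lemma catK_shift: "catK (1 / 2 + e) = sqrt (e * (1 + e))"
  by (simp add: catK_def power2_eq_square algebra_simps)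

lemma cosh_double_sinh: "cosh (2 * s :: real) = 1 + 2 * (sinh s)\<^sup>2"
  by (simp add: cosh_double cosh_square_eq)

lemma catB_shift: "catB (1 / 2 + e) s = sqrt (e + (1 + 2 * e) * (sinh s)\<^sup>2)"
  unfolding catB_def cosh_double_sinh by (simp add: algebra_simps)

lemma catA_shift: "catA (1 / 2 + e) s = sqrt (1 + e + (1 + 2 * e) * (sinh s)\<^sup>2)"
  unfolding catA_def cosh_double_sinh by (simp add: algebra_simps)

lemma catB_pos: "e > 0 \<Longrightarrow> catB (1 / 2 + e) s > 0"
  unfolding catB_shift by (simp add: add_pos_nonneg)

lemma catA_pos: "e > 0 \<Longrightarrow> catA (1 / 2 + e) s > 0"
  unfolding catA_shift by (simp add: add_pos_nonneg)

lemma catK_pos: "e > 0 \<Longrightarrow> catK (1 / 2 + e) > 0"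
  unfolding catK_shift by simp

lemma continuous_on_catphi_integrand:
  assumes "e > 0"
  shows "continuous_on T (\<lambda>t. catK (1 / 2 + e) / ((catA (1 / 2 + e) t)\<^sup>2 * catB (1 / 2 + e) t))"
proof -
  have nz: "(catA (1 / 2 + e) t)\<^sup>2 * catB (1 / 2 + e) t \<noteq> 0" for t
    using catA_pos[OF assms, of t] catB_pos[OF assms, of t] by simp
  have "continuous_on T (catA (1 / 2 + e))" "continuous_on T (catB (1 / 2 + e))"
    unfolding catA_def[abs_def] catB_def[abs_def] by (intro continuous_intros)+
  then show ?thesis by (intro continuous_intros) (use nz in auto)
qed

lemma catphi_eq_integral:
  assumes "e > 0" "0 \<le> s"
  shows "catphi (1 / 2 + e) s
    = integral {0..s} (\<lambda>t. catK (1 / 2 + e) / ((catA (1 / 2 + e) t)\<^sup>2 * catB (1 / 2 + e) t))"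
  unfolding catphi_def zero_ereal_def using assms
  by (intro interval_integral_eq_integral borel_integrable_atLeastAtMost' continuous_on_catphi_integrand)

lemma catphi_mono:
  assumes "e > 0" "0 \<le> s" "s \<le> t"
  shows "catphi (1 / 2 + e) s \<le> catphi (1 / 2 + e) t"
proof -
  let ?f = "\<lambda>t. catK (1 / 2 + e) / ((catA (1 / 2 + e) t)\<^sup>2 * catB (1 / 2 + e) t)"
  have "integral {0..s} ?f \<le> integral {0..t} ?f"
  proof (rule integral_subset_le)
    show "?f integrable_on {0..s}" "?f integrable_on {0..t}"
      by (intro integrable_continuous_real continuous_on_catphi_integrand assms(1))+
    show "\<forall>x\<in>{0..t}. 0 \<le> ?f x"
      using catK_pos[OF assms(1)] catB_pos[OF assms(1)] by (simp add: less_imp_le)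
  qed (use assms in auto)
  moreover have "0 \<le> t" using assms by linarith
  ultimately show ?thesis
    using assms by (simp only: catphi_eq_integral)
qed

text \<open>In this form the right side of the boundary equation visibly decreases in \<open>s\<close>; the partial
  fractions come from \<open>e + (1 + 2 e) S = e (1 + S) + (1 + e) S\<close> with \<open>S = (sinh s)\<^sup>2\<close>.\<close>

lemma rhs_shift:
  assumes "e > 0" "s > 0"
  shows "catB (1 / 2 + e) s * catK (1 / 2 + e) / ((1 / 2 + e) * sinh (2 * s))
    = catK (1 / 2 + e) / (1 + 2 * e) * sqrt (e / (sinh s)\<^sup>2 + (1 + e) / (1 + (sinh s)\<^sup>2))"
proof -
  define S where "S = (sinh s)\<^sup>2"
  have S: "S > 0" using assms by (simp add: S_def)
  have "sinh s = sqrt S" using assms by (simp add: S_def)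
  moreover have "cosh s = sqrt (1 + S)"
    by (rule real_sqrt_unique[symmetric]) (simp_all add: S_def cosh_square_eq)
  ultimately have den: "(1 / 2 + e) * sinh (2 * s) = (1 + 2 * e) * sqrt (S * (1 + S))"
    unfolding sinh_double real_sqrt_mult by (simp add: distrib_right)
  have "e / S + (1 + e) / (1 + S) = (e + (1 + 2 * e) * S) / (S * (1 + S))"
    using S by (simp add: field_simps)
  then have "sqrt (e / S + (1 + e) / (1 + S)) = catB (1 / 2 + e) s / sqrt (S * (1 + S))"
    by (simp add: catB_shift S_def real_sqrt_divide)
  then show ?thesis unfolding den S_def[symmetric] by simp
qed

lemma rhs_strict_decreasing:
  assumes "e > 0" "0 < s" "s < t"
  shows "catB (1 / 2 + e) t * catK (1 / 2 + e) / ((1 / 2 + e) * sinh (2 * t))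
       < catB (1 / 2 + e) s * catK (1 / 2 + e) / ((1 / 2 + e) * sinh (2 * s))"
proof -
  define S T where "S = (sinh s)\<^sup>2" and "T = (sinh t)\<^sup>2"
  have "0 < sinh s" "sinh s < sinh t" using assms by auto
  then have S: "0 < S" "S < T" unfolding S_def T_def by (auto intro: power_strict_mono)
  have "e / T < e / S" "(1 + e) / (1 + T) < (1 + e) / (1 + S)"
    using S assms(1) by (intro divide_strict_left_mono mult_pos_pos; linarith)+
  then have "sqrt (e / T + (1 + e) / (1 + T)) < sqrt (e / S + (1 + e) / (1 + S))"
    by simp
  moreover have "catK (1 / 2 + e) / (1 + 2 * e) > 0" using assms(1) catK_pos by simp
  moreover have "t > 0" using assms by linarith
  ultimately show ?thesis
    unfolding rhs_shift[OF assms(1,2)] rhs_shift[OF assms(1) \<open>t > 0\<close>] S_def T_def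
    by (intro mult_strict_left_mono)
qed

text \<open>The left side of the boundary equation is nondecreasing and the right side strictly decreasing,
  so any positive solution is the only one.\<close>

lemma s0_eqI:
  assumes "e > 0" "s > 0"
    and eq: "tanh (catphi (1 / 2 + e) s) = catB (1 / 2 + e) s * catK (1 / 2 + e) / ((1 / 2 + e) * sinh (2 * s))"
  shows "s0 (1 / 2 + e) = s"
  unfolding s0_def
proof (rule the_equality)
  show "0 < s \<and> tanh (catphi (1 / 2 + e) s) = catB (1 / 2 + e) s * catK (1 / 2 + e) / ((1 / 2 + e) * sinh (2 * s))"
    using assms by blast
  fix t
  assume t: "0 < t \<and> tanh (catphi (1 / 2 + e) t) = catB (1 / 2 + e) t * catK (1 / 2 + e) / ((1 / 2 + e) * sinh (2 * t))"
  have mono: "tanh (catphi (1 / 2 + e) x) \<le> tanh (catphi (1 / 2 + e) y)" if "0 < x" "x < y" for x y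
    using catphi_mono[of e x y] that assms(1) by simp
  show "t = s"
  proof (cases t s rule: linorder_cases)
    case less
    then show ?thesis using mono[of t s] rhs_strict_decreasing[of e t s] t eq assms by linarith
  next
    case greater
    then show ?thesis using mono[of s t] rhs_strict_decreasing[of e s t] t eq assms by linarith
  qed
qed

text \<open>The parameter \<open>s\<close> of the catenoid as a function of the rescaled variable \<open>u\<close>.\<close>

definition profile_param :: "real \<Rightarrow> real \<Rightarrow> real" where
  "profile_param e u = arsinh (sqrt (e / (1 + 2 * e)) * sinh u)"

lemma sinh_profile_param_sq: "e > 0 \<Longrightarrow> (1 + 2 * e) * (sinh (profile_param e u))\<^sup>2 = e * (sinh u)\<^sup>2"
  by (simp add: profile_param_def power_mult_distrib)

lemma cosh_profile_param:
  assumes "e > 0" shows "cosh (profile_param e u) = sqrt (radC e u) / sqrt (1 + 2 * e)"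
proof -
  have "(sqrt (e / (1 + 2 * e)) * sinh u)\<^sup>2 + 1 = radC e u / (1 + 2 * e)"
    using assms by (simp add: radC_def power_mult_distrib cosh_square_eq field_simps)
  then show ?thesis by (simp add: profile_param_def cosh_arsinh_real real_sqrt_divide)
qed

lemma catA_profile_param: "e > 0 \<Longrightarrow> catA (1 / 2 + e) (profile_param e u) = sqrt (radA e u)"
  unfolding catA_shift sinh_profile_param_sq by (simp add: radA_def cosh_square_eq algebra_simps)

lemma catB_profile_param: "e > 0 \<Longrightarrow> catB (1 / 2 + e) (profile_param e u) = sqrt e * cosh u"
proof -
  assume "e > 0"
  then have "catB (1 / 2 + e) (profile_param e u) = sqrt (e * (cosh u)\<^sup>2)"
    unfolding catB_shift sinh_profile_param_sq[OF \<open>e > 0\<close>] by (simp add: cosh_square_eq algebra_simps)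
  then show ?thesis by (simp add: real_sqrt_mult)
qed

lemma DERIV_profile_param:
  assumes "e > 0"
  shows "(profile_param e has_real_derivative sqrt e * cosh u / sqrt (radC e u)) (at u)"
proof -
  have "(profile_param e has_real_derivative
      1 / sqrt ((sqrt (e / (1 + 2 * e)) * sinh u)\<^sup>2 + 1) * (sqrt (e / (1 + 2 * e)) * cosh u)) (at u)"
    unfolding profile_param_def[abs_def] by (rule DERIV_chain2[OF arsinh_real_has_field_derivative])
      (auto intro!: derivative_eq_intros)
  moreover have "sqrt ((sqrt (e / (1 + 2 * e)) * sinh u)\<^sup>2 + 1) = sqrt (radC e u) / sqrt (1 + 2 * e)"
    using cosh_profile_param[OF assms, of u] by (simp add: profile_param_def cosh_arsinh_real)
  ultimately show ?thesis using assms by (simp add: real_sqrt_divide mult_ac)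
qed

lemma catphi_profile_param:
  assumes e: "e > 0" and u: "0 \<le> u"
  shows "catphi (1 / 2 + e) (profile_param e u) = catK (1 / 2 + e) * integral {0..u} (phi_ker e)"
proof -
  let ?f = "\<lambda>t. catK (1 / 2 + e) / ((catA (1 / 2 + e) t)\<^sup>2 * catB (1 / 2 + e) t)"
  have n0: "profile_param e 0 = 0" by (simp add: profile_param_def)
  have mono: "profile_param e v \<le> profile_param e w" if "v \<le> w" for v w
  proof -
    have "sqrt (e / (1 + 2 * e)) * sinh v \<le> sqrt (e / (1 + 2 * e)) * sinh w"
      using that e by (intro mult_left_mono) auto
    then show ?thesis unfolding profile_param_def by (meson arsinh_less_iff_real not_less)
  qed
  have "((\<lambda>v. (sqrt e * cosh v / sqrt (radC e v)) *\<^sub>R ?f (profile_param e v)) has_integral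
      integral {profile_param e 0..profile_param e u} ?f) {0..u}"
  proof (rule has_integral_substitution[where c = 0 and d = "profile_param e u"])
    show "profile_param e ` {0..u} \<subseteq> {0..profile_param e u}" using mono[of 0] mono[of _ u] by (auto simp: n0)
  qed (use u mono[OF u] in \<open>auto intro!: continuous_on_catphi_integrand[OF e]
        DERIV_profile_param[OF e, THEN has_field_derivative_at_within]\<close>)
  moreover have "(sqrt e * cosh v / sqrt (radC e v)) *\<^sub>R ?f (profile_param e v) = catK (1 / 2 + e) * phi_ker e v" for v
    using e rad_pos_right[OF e, of v] by (simp add: catA_profile_param catB_profile_param phi_ker_def)
  ultimately have "((\<lambda>v. catK (1 / 2 + e) * phi_ker e v) has_integral integral {0..profile_param e u} ?f) {0..u}"
    by (simp only: n0)
  note I = integral_unique[OF this]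
  have "catK (1 / 2 + e) * integral {0..u} (phi_ker e) = integral {0..u} (\<lambda>v. catK (1 / 2 + e) * phi_ker e v)"
    by simp
  also note I
  also have "integral {0..profile_param e u} ?f = catphi (1 / 2 + e) (profile_param e u)"
    using mono[OF u] n0 by (intro catphi_eq_integral[symmetric] e) simp
  finally show ?thesis by (rule sym)
qed

lemma rhs_profile_param:
  assumes e: "e > 0" and u: "0 < u"
  shows "catB (1 / 2 + e) (profile_param e u) * catK (1 / 2 + e) / ((1 / 2 + e) * sinh (2 * profile_param e u))
    = catK (1 / 2 + e) * rhs_over_K e u"
proof -
  have E: "radC e u > 0" using rad_pos_right[OF e] by blast
  have sinh: "sinh (profile_param e u) = sqrt e / sqrt (1 + 2 * e) * sinh u"
    by (simp add: profile_param_def real_sqrt_divide)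
  have "(1 / 2 + e) * sinh (2 * profile_param e u) = (1 + 2 * e) * (sinh (profile_param e u) * cosh (profile_param e u))"
    unfolding sinh_double by (simp add: algebra_simps)
  also have "\<dots> = ((1 + 2 * e) / (sqrt (1 + 2 * e) * sqrt (1 + 2 * e))) * (sqrt e * sinh u * sqrt (radC e u))"
    unfolding sinh cosh_profile_param[OF e] by simp
  also have "\<dots> = sqrt e * sinh u * sqrt (radC e u)" using e by simp
  finally show ?thesis using e E u by (simp add: catB_profile_param rhs_over_K_def)
qed

lemma s0_eq_profile_param:
  assumes e: "e > 0" "e \<in> param_dom" and u: "u \<in> height_dom" and root: "defect e u = 0"
  shows "s0 (1 / 2 + e) = profile_param e u" "tanh (catphi (1 / 2 + e) (profile_param e u)) = catK (1 / 2 + e) * rhs_over_K e u"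
proof -
  have u0: "u > 0" using u by (simp add: height_dom_def)
  define x where "x = catK (1 / 2 + e) * rhs_over_K e u"
  have x2: "x\<^sup>2 = e * (1 + e) * (rhs_over_K e u)\<^sup>2"
    using e by (simp add: x_def catK_shift power_mult_distrib)
  have "x\<^sup>2 < 1" using rhs_over_K_arg_less_1[OF e(2) u] unfolding x2 by linarith
  then have x1: "\<bar>x\<bar> < 1" by (simp add: abs_square_less_1)
  have "catphi (1 / 2 + e) (profile_param e u) = catK (1 / 2 + e) * artanh_over_K e u"
    using root u0 by (simp add: catphi_profile_param[OF e(1)] defect_def)
  also have "\<dots> = artanh x"
    unfolding artanh_eq_artanhc[OF x1] x2 by (simp add: artanh_over_K_def x_def)
  finally show t: "tanh (catphi (1 / 2 + e) (profile_param e u)) = catK (1 / 2 + e) * rhs_over_K e u"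
    using tanh_artanh_real[OF x1] by (simp add: x_def)
  have "profile_param e u > 0" using e u0 by (simp add: profile_param_def)
  then show "s0 (1 / 2 + e) = profile_param e u"
    using rhs_profile_param[OF e(1) u0] t e(1) by (intro s0_eqI) auto
qed

text \<open>Since \<open>1 / (cosh \<phi>)\<^sup>2 = 1 - (tanh \<phi>)\<^sup>2\<close>, the boundary equation eliminates \<open>\<phi>\<close> from \<open>cosh r\<close>. With
  \<open>S = (sinh u)\<^sup>2\<close> the outcome factors, because
  \<open>S radC - e (1 + e) (1 + S) = (S - e) radA\<close>, and \<open>(sinh r)\<^sup>2 = e (1 + S)\<^sup>2 / (S - e)\<close>.\<close>

lemma ball_radius_eq_arsinh:
  assumes e: "e > 0" "e \<in> param_dom" and u: "u \<in> height_dom" and root: "defect e u = 0"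
  shows "ball_radius (1 / 2 + e) = arsinh (catK (1 / 2 + e) * Hprofile e u)"
proof -
  define S where "S = (sinh u)\<^sup>2"
  define p where "p = catphi (1 / 2 + e) (profile_param e u)"
  define r where "r = arsinh (catK (1 / 2 + e) * Hprofile e u)"
  have S: "S > 1" using sinh_sq_gt_1[of u] u by (auto simp: S_def height_dom_def)
  have e1: "e < 1" using e by (simp add: param_dom_def)
  have C: "(cosh u)\<^sup>2 = 1 + S" by (simp add: S_def cosh_square_eq)
  have E: "radC e u = 1 + e + e * (1 + S)" and P: "radA e u = 1 + e * (1 + S)"
    by (simp_all add: radC_def radA_def C)
  have Epos: "radC e u > 0" and Ppos: "radA e u > 0" using rad_pos_right[OF e(1)] by auto
  have SE: "S - e > 0" using S e1 by simp
  have K2: "(catK (1 / 2 + e))\<^sup>2 = e * (1 + e)" using e by (simp add: catK_shift)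
  have q2: "(rhs_over_K e u)\<^sup>2 = (1 + S) / (S * radC e u)"
    using Epos by (simp add: rhs_over_K_def power_divide power_mult_distrib C S_def)
  have H2: "(Hprofile e u)\<^sup>2 = (1 + S)\<^sup>2 / ((1 + e) * (S - e))"
    using SE e by (simp add: Hprofile_def power_divide C flip: S_def)
  have "(tanh p)\<^sup>2 = e * (1 + e) * ((1 + S) / (S * radC e u))"
    using s0_eq_profile_param(2)[OF assms] by (simp add: p_def power_mult_distrib K2 q2)
  then have "1 - (tanh p)\<^sup>2 = (S * radC e u - e * (1 + e) * (1 + S)) / (S * radC e u)"
    using S Epos by (simp add: diff_divide_distrib)
  also have "S * radC e u - e * (1 + e) * (1 + S) = (S - e) * radA e u"
    unfolding E P by (simp add: algebra_simps power2_eq_square)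
  finally have t: "1 - (tanh p)\<^sup>2 = (S - e) * radA e u / (S * radC e u)" .
  have "1 = (cosh p)\<^sup>2 - (sinh p)\<^sup>2" by (simp add: cosh_square_eq)
  also have "\<dots> = (cosh p)\<^sup>2 * (1 - (tanh p)\<^sup>2)"
    by (simp add: tanh_def power_divide algebra_simps)
  finally have "(cosh p)\<^sup>2 = S * radC e u / ((S - e) * radA e u)"
    unfolding t using S SE Epos Ppos by (simp add: field_simps)
  then have "(catA (1 / 2 + e) (profile_param e u) * cosh p)\<^sup>2 = S * radC e u / (S - e)"
    using Ppos SE by (simp add: catA_profile_param[OF e(1)] power_mult_distrib)
  also have "\<dots> = (catK (1 / 2 + e) * Hprofile e u)\<^sup>2 + 1"
    unfolding power_mult_distrib K2 H2 E using SE e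
    by (simp add: divide_simps) (simp add: algebra_simps power2_eq_square)
  also have "\<dots> = (cosh r)\<^sup>2" by (simp add: r_def cosh_arsinh_real)
  finally have sq: "(catA (1 / 2 + e) (profile_param e u) * cosh p)\<^sup>2 = (cosh r)\<^sup>2" .
  have nonneg: "0 \<le> catA (1 / 2 + e) (profile_param e u) * cosh p"
    by (intro mult_nonneg_nonneg less_imp_le[OF catA_pos[OF e(1)]] cosh_real_nonneg)
  have cosh_r: "cosh r = catA (1 / 2 + e) (profile_param e u) * cosh p"
    by (rule power2_eq_imp_eq[OF sq[symmetric] cosh_real_nonneg nonneg])
  have "Hprofile e u > 0" using Hprofile_arg_pos[OF e(2) u] by (simp add: Hprofile_def)
  then have r0: "r > 0" using catK_pos[OF e(1)] by (simp add: r_def)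
  show ?thesis
    unfolding ball_radius_def s0_eq_profile_param(1)[OF assms] p_def[symmetric] cosh_r[symmetric] r_def[symmetric]
    by (rule the_equality) (use r0 in auto)
qed

section \<open>Asymptotics\<close>

lemma DERIV_imp_linear_bound:
  fixes f :: "real \<Rightarrow> real"
  assumes "\<exists>D. (f has_real_derivative D) (at 0)"
  obtains M \<epsilon> where "M > 0" "\<epsilon> > 0" "\<And>x. \<bar>x\<bar> < \<epsilon> \<Longrightarrow> \<bar>f x - f 0\<bar> \<le> M * \<bar>x\<bar>"
proof -
  obtain D where "(f has_real_derivative D) (at 0)" using assms by blast
  then have "(\<lambda>x. (f x - f 0) / x) \<midarrow>0\<rightarrow> D" by (simp add: has_field_derivative_iff)
  from LIM_D[OF this zero_less_one] obtain \<epsilon> where \<epsilon>: "\<epsilon> > 0"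
    and near: "\<And>x. x \<noteq> 0 \<and> norm (x - 0) < \<epsilon> \<Longrightarrow> norm ((f x - f 0) / x - D) < 1"
    by auto
  show thesis
  proof (rule that[of "\<bar>D\<bar> + 1" \<epsilon>])
    fix x :: real assume x: "\<bar>x\<bar> < \<epsilon>"
    show "\<bar>f x - f 0\<bar> \<le> (\<bar>D\<bar> + 1) * \<bar>x\<bar>"
    proof (cases "x = 0")
      case False
      then have "\<bar>(f x - f 0) / x - D\<bar> < 1" using near[of x] x by simp
      then have "\<bar>(f x - f 0) / x\<bar> \<le> \<bar>D\<bar> + 1" by linarith
      then show ?thesis using False by (simp add: abs_divide divide_le_eq)
    qed simp
  qed (use \<epsilon> in auto)
qed

text \<open>Everything the asymptotics need to know about the radius: it is carried by a function \<open>h\<close> that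
  is defined on both sides of \<open>e = 0\<close> and twice differentiable there.\<close>

lemma radius_curve:
  obtains \<delta> h h' where "\<delta> > 0" "h 0 = sigma_star * cosh sigma_star" "h' 0 = C0"
    "\<And>e. \<bar>e\<bar> < \<delta> \<Longrightarrow> (h has_real_derivative h' e) (at e)"
    "\<exists>D. (h' has_real_derivative D) (at 0)"
    "\<And>e. 0 < e \<Longrightarrow> e < \<delta> \<Longrightarrow> ball_radius (1 / 2 + e) = arsinh (catK (1 / 2 + e) * h e)"
proof -
  obtain \<delta> U where \<delta>: "\<delta> > 0" and sub: "ball 0 \<delta> \<subseteq> param_dom" and U0: "U 0 = sigma_star"
    and U: "\<And>e. e \<in> ball 0 \<delta> \<Longrightarrow> U e \<in> height_dom \<and> defect e (U e) = 0 \<and> defect_u e (U e) > 0 \<and>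
       (U has_real_derivative - defect_e e (U e) / defect_u e (U e)) (at e)"
    using root_curve by blast
  define V where "V = (\<lambda>e. - defect_e e (U e) / defect_u e (U e))"
  have at0: "U 0 \<in> height_dom" "defect_u 0 (U 0) > 0" "(U has_real_derivative V 0) (at 0)"
    using U[of 0] \<delta> by (auto simp: V_def)
  obtain D where D: "(V has_real_derivative D) (at 0)"
    using root_curve_second_derivative[OF at0] unfolding V_def by blast
  show thesis
  proof (rule that[of \<delta> "\<lambda>e. Hprofile e (U e)" "\<lambda>e. Hprofile_deriv e (U e) (V e)"])
    show "Hprofile_deriv 0 (U 0) (V 0) = C0" using Hprofile_deriv_0 by (simp only: V_def U0)
    show "((\<lambda>e. Hprofile e (U e)) has_real_derivative Hprofile_deriv e (U e) (V e)) (at e)" if "\<bar>e\<bar> < \<delta>" for e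
      unfolding V_def using U[of e] sub that by (intro DERIV_Hprofile) auto
    show "\<exists>D. ((\<lambda>e. Hprofile_deriv e (U e) (V e)) has_real_derivative D) (at 0)"
      using DERIV_Hprofile_deriv[OF at0(1,3) D] .
    show "ball_radius (1 / 2 + e) = arsinh (catK (1 / 2 + e) * Hprofile e (U e))" if "0 < e" "e < \<delta>" for e
      using U[of e] sub that by (intro ball_radius_eq_arsinh) auto
  qed (simp_all add: \<delta> U0 Hprofile_0)
qed

lemma DERIV_catK:
  assumes "a > 1 / 2" shows "(catK has_real_derivative a / catK a) (at a)"
proof -
  have "a\<^sup>2 - 1 / 4 > 0"
    using power_strict_mono[of "1/2" a 2] assms by (simp add: power2_eq_square)
  then show ?thesis
    unfolding catK_def[abs_def] by (auto intro!: derivative_eq_intros simp: field_simps)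
qed

theorem theorem11p9:
  shows "(\<lambda>a. H a - (sigma_star * cosh sigma_star + C0 * (a - 1 / 2)))
            \<in> O[at_right (1 / 2)](\<lambda>a. (a - 1 / 2)\<^sup>2)
       \<and> (deriv H \<longlongrightarrow> C0) (at_right (1 / 2))
       \<and> C0 > 0
       \<and> (\<lambda>a. g a - C0 * (a - 1 / 2) powr (3 / 2))
            \<in> O[at_right (1 / 2)](\<lambda>a. (a - 1 / 2) powr (5 / 2))"
proof -
  obtain \<delta> h h' where \<delta>: "\<delta> > 0" and h0: "h 0 = sigma_star * cosh sigma_star" and h'0: "h' 0 = C0"
    and h: "\<And>e. \<bar>e\<bar> < \<delta> \<Longrightarrow> (h has_real_derivative h' e) (at e)"
    and h'': "\<exists>D. (h' has_real_derivative D) (at 0)"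
    and radius: "\<And>e. 0 < e \<Longrightarrow> e < \<delta> \<Longrightarrow> ball_radius (1 / 2 + e) = arsinh (catK (1 / 2 + e) * h e)"
    using radius_curve by blast
  have right: "\<forall>\<^sub>F a in at_right (1 / 2). a \<in> {1 / 2<..<1 / 2 + d}" if "d > 0" for d :: real
    using that by (intro eventually_at_right_real) simp
  have near: "\<forall>\<^sub>F b in nhds a. b \<in> {1 / 2<..<1 / 2 + \<delta>}" if "a \<in> {1 / 2<..<1 / 2 + \<delta>}" for a
    using that by (intro eventually_nhds_in_open) auto
  have radius': "ball_radius a = arsinh (catK a * h (a - 1 / 2))" if "a \<in> {1 / 2<..<1 / 2 + \<delta>}" for a
    using radius[of "a - 1 / 2"] that by simp
  have K: "catK a > 0" if "a > 1 / 2" for a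
    using catK_pos[of "a - 1 / 2"] that by simp
  have Hh: "H a = h (a - 1 / 2)" if "a \<in> {1 / 2<..<1 / 2 + \<delta>}" for a
    using K[of a] that by (simp add: H_def radius')
  have Dh: "((\<lambda>a. h (a - 1 / 2)) has_real_derivative h' (a - 1 / 2)) (at a)"
    if "a \<in> {1 / 2<..<1 / 2 + \<delta>}" for a
  proof -
    have "((\<lambda>a. a - 1 / 2) has_real_derivative 1) (at a)" by (auto intro!: derivative_eq_intros)
    from DERIV_chain2[OF h this] show ?thesis using that by simp
  qed

  have expansion: "(\<lambda>a. H a - (sigma_star * cosh sigma_star + C0 * (a - 1 / 2)))
            \<in> O[at_right (1 / 2)](\<lambda>a. (a - 1 / 2)\<^sup>2)"
  proof -
    obtain M \<epsilon> where M: "M > 0" "\<epsilon> > 0" "\<And>x. \<bar>x\<bar> < \<epsilon> \<Longrightarrow> \<bar>h' x - h' 0\<bar> \<le> M * \<bar>x\<bar>"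
      using DERIV_imp_linear_bound[OF h''] by blast
    show ?thesis
    proof (rule bigoI)
      have "min \<delta> \<epsilon> > 0" using \<delta> M by simp
      from right[OF this] show "\<forall>\<^sub>F a in at_right (1 / 2).
          norm (H a - (sigma_star * cosh sigma_star + C0 * (a - 1 / 2))) \<le> M * norm ((a - 1 / 2)\<^sup>2)"
      proof eventually_elim
        case (elim a)
        define e where "e = a - 1 / 2"
        have e: "0 < e" "e < \<delta>" "e < \<epsilon>" using elim by (auto simp: e_def)
        have "\<exists>z. 0 < z \<and> z < e \<and> h e - h 0 = (e - 0) * h' z"
          using e by (intro MVT2 h) auto
        then obtain z where z: "0 < z" "z < e" "h e - h 0 = e * h' z" by auto
        have "H a - (sigma_star * cosh sigma_star + C0 * e) = e * (h' z - h' 0)"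
        proof -
          have "H a = h e" using Hh[of a] e by (simp add: e_def)
          then have "H a - (sigma_star * cosh sigma_star + C0 * e) = (h e - h 0) - h' 0 * e"
            using h0 h'0 by simp
          then show ?thesis unfolding z(3) by (simp add: algebra_simps)
        qed
        moreover have "\<bar>h' z - h' 0\<bar> \<le> M * e"
        proof -
          have "\<bar>h' z - h' 0\<bar> \<le> M * z" using M(3)[of z] z e by simp
          also have "\<dots> \<le> M * e" using z M(1) by (intro mult_left_mono) auto
          finally show ?thesis .
        qed
        ultimately have "\<bar>H a - (sigma_star * cosh sigma_star + C0 * e)\<bar> \<le> e * (M * e)"
          using e by (simp add: abs_mult)
        then show ?case by (simp add: e_def power2_eq_square mult_ac)
      qed
    qed
  qed

  have "isCont h' 0" using h'' by (blast intro: DERIV_isCont)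
  moreover have "((\<lambda>a. a - 1 / 2 :: real) \<longlongrightarrow> 1 / 2 - 1 / 2) (at_right (1 / 2))"
    by (intro tendsto_intros)
  then have "((\<lambda>a. a - 1 / 2 :: real) \<longlongrightarrow> 0) (at_right (1 / 2))" by simp
  ultimately have "((\<lambda>a. h' (a - 1 / 2)) \<longlongrightarrow> C0) (at_right (1 / 2))"
    unfolding h'0[symmetric] by (rule isCont_tendsto_compose)
  moreover have "\<forall>\<^sub>F a in at_right (1 / 2). h' (a - 1 / 2) = deriv H a"
    using right[OF \<delta>]
  proof eventually_elim
    case (elim a)
    have ev: "\<forall>\<^sub>F b in nhds a. h (b - 1 / 2) = H b"
      using near[OF elim] by eventually_elim (simp add: Hh)
    have "(H has_real_derivative h' (a - 1 / 2)) (at a)"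
      by (rule iffD1[OF DERIV_cong_ev[OF refl ev refl] Dh[OF elim]])
    then show ?case by (rule DERIV_imp_deriv[symmetric])
  qed
  ultimately have derivative: "(deriv H \<longlongrightarrow> C0) (at_right (1 / 2))"
    by (rule Lim_transform_eventually)

  \<comment> \<open>\<open>G\<close> is \<open>g\<close> divided by \<open>e powr (3/2)\<close>.\<close>
  define G where "G = (\<lambda>e. (1 + e) * sqrt (1 + e) * h' e / sqrt (e * (1 + e) * (h e)\<^sup>2 + 1))"
  have g_eq: "g a = (a - 1 / 2) powr (3 / 2) * G (a - 1 / 2)" if a: "a \<in> {1 / 2<..<1 / 2 + \<delta>}" for a
  proof -
    define e where "e = a - 1 / 2"
    define k where "k = catK a"
    define R where "R = sqrt ((k * h e)\<^sup>2 + 1)"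
    have e: "e > 0" using a by (simp add: e_def)
    have k: "k > 0" using K[of a] a by (simp add: k_def)
    have k_eq: "k = sqrt e * sqrt (1 + e)"
      using catK_shift[of e] by (simp add: k_def e_def real_sqrt_mult)
    have R: "R > 0" by (simp add: R_def add_nonneg_pos)
    have "((\<lambda>b. catK b * h (b - 1 / 2)) has_real_derivative a / k * h e + h' e * k) (at a)"
      using DERIV_mult[OF DERIV_catK[of a] Dh[OF a]] a by (simp add: k_def e_def)
    from DERIV_chain2[OF arsinh_real_has_field_derivative this]
    have darsinh: "((\<lambda>b. arsinh (catK b * h (b - 1 / 2))) has_real_derivative
        1 / R * (a / k * h e + h' e * k)) (at a)"
      by (simp add: R_def k_def e_def)
    have ev: "\<forall>\<^sub>F b in nhds a. arsinh (catK b * h (b - 1 / 2)) = ball_radius b"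
      using near[OF a] by eventually_elim (simp add: radius')
    have "(ball_radius has_real_derivative 1 / R * (a / k * h e + h' e * k)) (at a)"
      by (rule iffD1[OF DERIV_cong_ev[OF refl ev refl] darsinh])
    then have "deriv ball_radius a = 1 / R * (a / k * h e + h' e * k)" by (rule DERIV_imp_deriv)
    moreover have "tanh (ball_radius a) = k * h e / R"
      using a by (simp add: radius' tanh_def cosh_arsinh_real R_def k_def e_def)
    ultimately have "g a = k\<^sup>2 * (1 / R * (a / k * h e + h' e * k)) - a * (k * h e / R)"
      by (simp add: g_def k_def)
    also have "\<dots> = k ^ 3 * h' e / R"
      using k R by (simp add: field_simps power2_eq_square power3_eq_cube)
    also have "k ^ 3 = e powr (3 / 2) * ((1 + e) * sqrt (1 + e))"
    proof -
      have "e powr (3 / 2) = e powr 1 * e powr (1 / 2)" by (subst powr_add[symmetric]) simp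
      then have "e powr (3 / 2) = e * sqrt e" using e by (simp add: powr_half_sqrt)
      moreover have "k * k = e * (1 + e)"
      proof -
        have "k * k = (sqrt e * sqrt e) * (sqrt (1 + e) * sqrt (1 + e))"
          unfolding k_eq by (simp only: mult_ac)
        then show ?thesis using e by simp
      qed
      then have "k ^ 3 = e * (1 + e) * (sqrt e * sqrt (1 + e))"
        unfolding power3_eq_cube by (simp only: k_eq[symmetric])
      ultimately show ?thesis by (simp only: mult_ac)
    qed
    also have "R = sqrt (e * (1 + e) * (h e)\<^sup>2 + 1)"
      using e by (simp add: R_def k_eq power_mult_distrib)
    finally show ?thesis by (simp add: G_def e_def)
  qed
  have "\<exists>D. (G has_real_derivative D) (at 0)"
  proof -
    obtain D where D: "(h' has_real_derivative D) (at 0)" using h'' by blast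
    have h00: "(h has_real_derivative h' 0) (at 0)" using h \<delta> by simp
    have s1: "((\<lambda>e. sqrt (1 + e)) has_real_derivative 1 / 2) (at 0)"
      by (auto intro!: derivative_eq_intros)
    have "\<exists>n. ((\<lambda>e. e * (1 + e) * (h e)\<^sup>2 + 1) has_real_derivative n) (at 0)"
      by (rule exI) (rule derivative_eq_intros h00 refl)+
    then obtain n where "((\<lambda>e. e * (1 + e) * (h e)\<^sup>2 + 1) has_real_derivative n) (at 0)" by blast
    from DERIV_chain2[OF DERIV_real_sqrt this]
    have s2: "((\<lambda>e. sqrt (e * (1 + e) * (h e)\<^sup>2 + 1)) has_real_derivative inverse (sqrt 1) / 2 * n) (at 0)"
      by simp
    show ?thesis
      unfolding G_def by (rule exI, (rule derivative_eq_intros D s1 s2 refl | simp; fail)+)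
  qed
  from DERIV_imp_linear_bound[OF this]
  obtain M \<epsilon> where M: "M > 0" "\<epsilon> > 0" "\<And>x. \<bar>x\<bar> < \<epsilon> \<Longrightarrow> \<bar>G x - G 0\<bar> \<le> M * \<bar>x\<bar>" by blast
  have G0: "G 0 = C0" by (simp add: G_def h'0)
  have "(\<lambda>a. g a - C0 * (a - 1 / 2) powr (3 / 2)) \<in> O[at_right (1 / 2)](\<lambda>a. (a - 1 / 2) powr (5 / 2))"
  proof (rule bigoI)
    have "min \<delta> \<epsilon> > 0" using \<delta> M by simp
    from right[OF this] show "\<forall>\<^sub>F a in at_right (1 / 2).
        norm (g a - C0 * (a - 1 / 2) powr (3 / 2)) \<le> M * norm ((a - 1 / 2) powr (5 / 2))"
    proof eventually_elim
      case (elim a)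
      define e where "e = a - 1 / 2"
      have e: "0 < e" "e < \<delta>" "e < \<epsilon>" using elim by (auto simp: e_def)
      have "g a = e powr (3 / 2) * G e" using g_eq[of a] e by (simp add: e_def)
      then have "g a - C0 * e powr (3 / 2) = e powr (3 / 2) * (G e - G 0)"
        using G0 by (simp add: right_diff_distrib)
      then have "\<bar>g a - C0 * e powr (3 / 2)\<bar> = e powr (3 / 2) * \<bar>G e - G 0\<bar>"
        by (simp add: abs_mult)
      also have "\<dots> \<le> e powr (3 / 2) * (M * e)"
        using M(3)[of e] e by (intro mult_left_mono) auto
      also have "\<dots> = M * (e powr (3 / 2) * e powr 1)" using e by simp
      also have "e powr (3 / 2) * e powr 1 = e powr (5 / 2)" by (subst powr_add[symmetric]) simp
      finally show ?case by (simp add: e_def)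
    qed
  qed
  with expansion derivative C0_pos show ?thesis by blast
qed

end
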